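(* Fix $c\in\mathbb{N}_0$ and let $\mathcal{G}$ be a graph class of bounded treewidth. The following are equivalent: (a) $\mathcal{G}$ has bounded $c$-tree-partition-width, i.e. $\sup_{G\in\mathcal{G}}\mathrm{tpw}_c(G)<\infty$; (b) for some $d,\ell\in\mathbb{N}$, every graph in $\mathcal{G}$ has a $(c,d)$-disjointed $\ell$-partition; (c) for some $d,\ell\in\mathbb{N}$, every graph in $\mathcal{G}$ has a $(c,d)$-disjointed $\ell$-covering; (d) for some $\ell\in\mathbb{N}$ and some function $f:\mathbb{N}\to\mathbb{R}^+$, every graph in $\mathcal{G}$ has a $(c,f)$-disjointed $\ell$-partition; (e) for some $\ell\in\mathbb{N}$ and some function $f:\mathbb{N}\to\mathbb{R}^+$, every graph in $\mathcal{G}$ has a $(c,f)$-disjointed $\ell$-covering.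
   Context: Graphs are finite, simple and undirected; $\mathrm{tw}$ denotes treewidth; a graph class is a set of graphs closed under isomorphism. For graphs $G,H$, an $H$-partition of $G$ is a partition $(V_x : x\in V(H))$ of $V(G)$ indexed by the vertices of $H$ such that for every edge $vw$ of $G$ with $v\in V_x$ and $w\in V_y$, either $x=y$ or $xy\in E(H)$; its width is $\max_{x}|V_x|$. For $c\in\mathbb{N}_0$, $\mathrm{tpw}_c(G)$ is the minimum width of an $H$-partition of $G$ over all graphs $H$ with $\mathrm{tw}(H)\le c$. For a set $B\subseteq V(G)$, $N_G(B)$ is the set of vertices of $G$ adjacent to some vertex of $B$ (so $N_G(\emptyset)=\emptyset$). An $\ell$-covering of $G$ is a set $\beta\subseteq 2^{V(G)}$ with $|B|\le \ell$ for all $B\in\beta$ and $\bigcup_{B\in\beta}B=V(G)$; it is an $\ell$-partition if its members are pairwise disjoint. For $c\in\mathbb{N}_0$ and $d\ge 0$, an $\ell$-covering $\beta$ is $(c,d)$-disjointed if for every $c$-tuple $(B_1,\dots,B_c)\in\beta^c$ and every connected component $X$ of $G-(B_1\cup\dots\cup B_c)$ there is $Q\subseteq V(X)$ with $|Q|\le d$ such that for every connected component $Y$ of $X-Q$ there is $i\in\{1,\dots,c\}$ with $V(Y)\cap N_G(B_i')=\emptyset$, where $B_i':=B_i\setminus(B_1\cup\dots\cup B_{i-1})$. For $t\in\mathbb{N}$, $\beta[t]:=\{\bigcup\mathcal{B} : \mathcal{B}\subseteq\beta, |\mathcal{B}|\le t\}$. For $f:\mathbb{N}\to\mathbb{R}^+$,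 $\beta$ is $(c,f)$-disjointed if $\beta[t]$ is $(c,f(t))$-disjointed for every $t\in\mathbb{N}$. *)

theory Defs
  imports Complex_Main
begin

type_synonym 'a graph = "'a set \<times> 'a set set"

definition verts :: "'a graph \<Rightarrow> 'a set" where
  "verts G = fst G"

definition edges :: "'a graph \<Rightarrow> 'a set set" where
  "edges G = snd G"

definition wf_graph :: "'a graph \<Rightarrow> bool" where
  "wf_graph G \<longleftrightarrow> finite (verts G) \<and>
     (\<forall>e\<in>edges G. e \<subseteq> verts G \<and> card e = 2)"

definition adj :: "'a graph \<Rightarrow> 'a \<Rightarrow> 'a \<Rightarrow> bool" where
  "adj G u v \<longleftrightarrow> {u, v} \<in> edges G"

definition graph_iso :: "'a graph \<Rightarrow> 'b graph \<Rightarrow> bool" where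
  "graph_iso G H \<longleftrightarrow> (\<exists>f. bij_betw f (verts G) (verts H) \<and>
     (\<forall>u\<in>verts G. \<forall>v\<in>verts G. adj G u v \<longleftrightarrow> adj H (f u) (f v)))"

definition graph_class :: "'a graph set \<Rightarrow> bool" where
  "graph_class \<G> \<longleftrightarrow> (\<forall>G\<in>\<G>. wf_graph G) \<and>
     (\<forall>G\<in>\<G>. \<forall>H. wf_graph H \<and> graph_iso G H \<longrightarrow> H \<in> \<G>)"

definition induced :: "'a graph \<Rightarrow> 'a set \<Rightarrow> 'a graph" where
  "induced G S = (verts G \<inter> S, {e \<in> edges G. e \<subseteq> S})"

definition del :: "'a graph \<Rightarrow> 'a set \<Rightarrow> 'a graph" where
  "del G S = induced G (verts G - S)"

definition connected_set :: "'a graph \<Rightarrow> 'a set \<Rightarrow> bool" where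
  "connected_set G C \<longleftrightarrow>
     (\<forall>u\<in>C. \<forall>v\<in>C. (\<lambda>x y. x \<in> C \<and> y \<in> C \<and> adj G x y)\<^sup>*\<^sup>* u v)"

definition connected_graph :: "'a graph \<Rightarrow> bool" where
  "connected_graph G \<longleftrightarrow> connected_set G (verts G)"

definition component :: "'a graph \<Rightarrow> 'a set \<Rightarrow> bool" where
  "component G C \<longleftrightarrow> C \<noteq> {} \<and> C \<subseteq> verts G \<and> connected_set G C \<and>
     (\<forall>u\<in>C. \<forall>v\<in>verts G. adj G u v \<longrightarrow> v \<in> C)"

definition nbhd :: "'a graph \<Rightarrow> 'a set \<Rightarrow> 'a set" where
  "nbhd G B = {v \<in> verts G. \<exists>u\<in>B. adj G u v}"

definition is_tree :: "'a graph \<Rightarrow> bool" where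
  "is_tree T \<longleftrightarrow> wf_graph T \<and> verts T \<noteq> {} \<and> connected_graph T \<and>
     card (edges T) + 1 = card (verts T)"

definition tree_decomp :: "'b graph \<Rightarrow> nat graph \<Rightarrow> (nat \<Rightarrow> 'b set) \<Rightarrow> bool" where
  "tree_decomp G T bag \<longleftrightarrow> is_tree T \<and>
     (\<forall>t\<in>verts T. bag t \<subseteq> verts G) \<and>
     (\<forall>v\<in>verts G. {t \<in> verts T. v \<in> bag t} \<noteq> {} \<and>
                   connected_set T {t \<in> verts T. v \<in> bag t}) \<and>
     (\<forall>e\<in>edges G. \<exists>t\<in>verts T. e \<subseteq> bag t)"

text \<open>Treewidth (as a natural number; the empty graph gets 0 instead of -1,
  which is irrelevant for conditions tw \<le> c with c \<ge> 0).\<close>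
definition treewidth :: "'b graph \<Rightarrow> nat" where
  "treewidth G = (LEAST k. \<exists>T bag. tree_decomp G T bag \<and>
                               (\<forall>t\<in>verts T. card (bag t) \<le> k + 1))"

definition H_partition :: "'a graph \<Rightarrow> 'b graph \<Rightarrow> ('b \<Rightarrow> 'a set) \<Rightarrow> bool" where
  "H_partition G H P \<longleftrightarrow>
     (\<Union>x\<in>verts H. P x) = verts G \<and>
     (\<forall>x\<in>verts H. \<forall>y\<in>verts H. x \<noteq> y \<longrightarrow> P x \<inter> P y = {}) \<and>
     (\<forall>x\<in>verts H. \<forall>y\<in>verts H. \<forall>v\<in>P x. \<forall>w\<in>P y.
         adj G v w \<longrightarrow> x = y \<or> adj H x y)"

definition partition_width :: "'b graph \<Rightarrow> ('b \<Rightarrow> 'a set) \<Rightarrow> nat" where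
  "partition_width H P = Max ({card (P x) | x. x \<in> verts H} \<union> {0})"

text \<open>tpw_c(G): minimum width of an H-partition of G over graphs H with tw(H) \<le> c.
  Every finite H is isomorphic to a graph on natural numbers, so H ranges over nat graphs.\<close>
definition tpw :: "nat \<Rightarrow> 'a graph \<Rightarrow> nat" where
  "tpw c G = (LEAST w. \<exists>(H :: nat graph) P. wf_graph H \<and> treewidth H \<le> c \<and>
                         H_partition G H P \<and> partition_width H P = w)"

definition covering :: "nat \<Rightarrow> 'a graph \<Rightarrow> 'a set set \<Rightarrow> bool" where
  "covering l G \<beta> \<longleftrightarrow> \<beta> \<subseteq> Pow (verts G) \<and> (\<forall>B\<in>\<beta>. card B \<le> l) \<and>
     \<Union>\<beta> = verts G"

definition lpartition :: "nat \<Rightarrow> 'a graph \<Rightarrow> 'a set set \<Rightarrow> bool" where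
  "lpartition l G \<beta> \<longleftrightarrow> covering l G \<beta> \<and>
     (\<forall>A\<in>\<beta>. \<forall>B\<in>\<beta>. A \<noteq> B \<longrightarrow> A \<inter> B = {})"

text \<open>(c,d)-disjointed: c-tuples (B_1,...,B_c) are encoded as functions B with
  B i \<in> \<beta> for i < c (indices shifted to 0,...,c-1).\<close>
definition disjointed :: "nat \<Rightarrow> real \<Rightarrow> 'a graph \<Rightarrow> 'a set set \<Rightarrow> bool" where
  "disjointed c d G \<beta> \<longleftrightarrow>
     (\<forall>B :: nat \<Rightarrow> 'a set. (\<forall>i<c. B i \<in> \<beta>) \<longrightarrow>
       (\<forall>X. component (del G (\<Union>i<c. B i)) X \<longrightarrow>
          (\<exists>Q \<subseteq> X. real (card Q) \<le> d \<and>
             (\<forall>Y. component (del (induced (del G (\<Union>i<c. B i)) X) Q) Y \<longrightarrow>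
                (\<exists>i<c. Y \<inter> nbhd G (B i - (\<Union>j<i. B j)) = {})))))"

definition union_family :: "'a set set \<Rightarrow> nat \<Rightarrow> 'a set set" where
  "union_family \<beta> t = {\<Union>\<B> | \<B>. \<B> \<subseteq> \<beta> \<and> card \<B> \<le> t}"

definition f_disjointed :: "nat \<Rightarrow> (nat \<Rightarrow> real) \<Rightarrow> 'a graph \<Rightarrow> 'a set set \<Rightarrow> bool" where
  "f_disjointed c f G \<beta> \<longleftrightarrow> (\<forall>t\<ge>1. disjointed c (f t) G (union_family \<beta> t))"

end

theory Submission
  imports Defs "HOL-Library.FuncSet"
begin

text \<open>Disjointedness for a family \<open>\<beta>\<close> passes to the unions of at most \<open>t\<close> of its members, with
  \<open>d\<close> replaced by \<open>t ^ c * d\<close>: take all sets \<open>Q\<close> obtained by choosing one member from each of the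
  \<open>c\<close> unions. So it suffices to go from tree-partitions to disjointed partitions and from
  disjointed coverings to tree-partitions. For the former, a tree decomposition of \<open>H\<close> of width
  at most \<open>c\<close> has a bag whose parts form the required \<open>Q\<close>.

  For the latter, the partition is grown part by part, so that every component \<open>X\<close> of the rest
  is adjacent to only \<open>c\<close> parts, and to each of them through a union of boundedly many members of
  \<open>\<beta>\<close>. Disjointedness yields \<open>Q \<subseteq> X\<close> such that every component of \<open>X - Q\<close> misses one of these
  parts. By balanced separators \<open>Q\<close> extends to a bounded set \<open>S\<close> to which every component of
  \<open>X - S\<close> attaches through a union of at most \<open>2 * (k + 1)\<close> members of \<open>\<beta>\<close>, a number independent
  of \<open>Q\<close>. Then \<open>S\<close> is the next part, and the process does not blow up.\<close>

section \<open>Connected sets and components\<close>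

abbreviation walk_in :: "'a graph \<Rightarrow> 'a set \<Rightarrow> 'a \<Rightarrow> 'a \<Rightarrow> bool" where
  "walk_in G C \<equiv> (\<lambda>x y. x \<in> C \<and> y \<in> C \<and> adj G x y)\<^sup>*\<^sup>*"

text \<open>A component of the subgraph induced on \<open>U\<close>, stated in \<open>G\<close>
  itself: nested deletions become set differences, with no change of graph.\<close>

definition comp_in :: "'a graph \<Rightarrow> 'a set \<Rightarrow> 'a set \<Rightarrow> bool" where
  "comp_in G U C \<longleftrightarrow> C \<noteq> {} \<and> C \<subseteq> U \<and> connected_set G C \<and> (\<forall>u\<in>C. \<forall>v\<in>U. adj G u v \<longrightarrow> v \<in> C)"

lemma adj_sym: "adj G u v \<Longrightarrow> adj G v u"
  by (simp add: adj_def insert_commute)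

lemma adj_verts: "wf_graph G \<Longrightarrow> adj G u v \<Longrightarrow> u \<in> verts G \<and> v \<in> verts G"
  by (auto simp: adj_def wf_graph_def)

lemma walk_in_mono: "walk_in G C u v \<Longrightarrow> C \<subseteq> D \<Longrightarrow> walk_in G D u v"
  by (erule mono_rtranclp[rule_format, rotated]) auto

lemma walk_in_sym: "walk_in G C u v \<Longrightarrow> walk_in G C v u"
proof (induction rule: rtranclp_induct)
  case (step y z)
  from step(2) have "z \<in> C \<and> y \<in> C \<and> adj G z y" by (auto intro: adj_sym)
  then show ?case using step(3) by (rule converse_rtranclp_into_rtranclp)
qed simp

lemma connected_setD: "connected_set G C \<Longrightarrow> u \<in> C \<Longrightarrow> v \<in> C \<Longrightarrow> walk_in G C u v"
  by (simp add: connected_set_def)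

lemma connected_setI_root:
  assumes "\<And>v. v \<in> C \<Longrightarrow> walk_in G C r v"
  shows "connected_set G C"
  unfolding connected_set_def
proof (intro ballI)
  fix u v assume "u \<in> C" "v \<in> C"
  then show "walk_in G C u v"
    using rtranclp_trans[OF walk_in_sym[OF assms] assms] by blast
qed

text \<open>Propagation along walks; this is how connected sets are confined to one side of a
  separation below.\<close>

lemma connected_set_closed_subset:
  assumes "connected_set G C" "u \<in> C" "u \<in> A"
    and "\<And>x y. x \<in> A \<Longrightarrow> x \<in> C \<Longrightarrow> y \<in> C \<Longrightarrow> adj G x y \<Longrightarrow> y \<in> A"
  shows "C \<subseteq> A"
proof
  fix v assume "v \<in> C"
  with assms(1,2) have "walk_in G C u v" by (rule connected_setD)
  then show "v \<in> A" by (induction rule: rtranclp_induct) (use assms in auto)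
qed

lemma connected_set_singleton: "connected_set G {v}"
  by (auto simp: connected_set_def)

lemma connected_set_Un:
  assumes "connected_set G A" "connected_set G B" "u \<in> A" "v \<in> B" "u = v \<or> adj G u v"
  shows "connected_set G (A \<union> B)"
proof (rule connected_setI_root)
  fix w assume w: "w \<in> A \<union> B"
  have A: "walk_in G (A \<union> B) u w" if "w \<in> A" for w
    using connected_setD[OF assms(1) \<open>u \<in> A\<close> that] by (rule walk_in_mono) auto
  have "walk_in G (A \<union> B) u v" using assms by auto
  moreover have "walk_in G (A \<union> B) v w" if "w \<in> B"
    using connected_setD[OF assms(2) \<open>v \<in> B\<close> that] by (rule walk_in_mono) auto
  ultimately show "walk_in G (A \<union> B) u w" using A w by auto
qed

lemma comp_in_exists:
  assumes "v \<in> U"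
  obtains C where "comp_in G U C" "v \<in> C"
proof
  let ?C = "{w. walk_in G U v w}"
  have sub: "?C \<subseteq> U"
  proof
    fix w assume "w \<in> ?C"
    then have "walk_in G U v w" by simp
    then show "w \<in> U" by cases (use assms in auto)
  qed
  have "connected_set G ?C"
  proof (rule connected_setI_root)
    fix w assume "w \<in> ?C"
    then have "walk_in G U v w" by simp
    then show "walk_in G ?C v w"
    proof (induction rule: rtranclp_induct)
      case (step y z)
      then have "walk_in G U v z" by (rule_tac rtranclp.rtrancl_into_rtrancl[of _ v y])
      with step have "y \<in> ?C \<and> z \<in> ?C \<and> adj G y z" by simp
      with step(3) show ?case by (rule rtranclp.rtrancl_into_rtrancl)
    qed simp
  qed
  moreover have "w' \<in> ?C" if "w \<in> ?C" "w' \<in> U" "adj G w w'" for w w'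
    using that sub by (auto intro: rtranclp.rtrancl_into_rtrancl[of _ v w])
  ultimately show "comp_in G U ?C"
    unfolding comp_in_def using sub by blast
qed simp

lemma comp_in_maximal:
  assumes "comp_in G U C" "connected_set G D" "D \<subseteq> U" "D \<inter> C \<noteq> {}"
  shows "D \<subseteq> C"
proof -
  obtain u where "u \<in> D" "u \<in> C" using assms(4) by auto
  then show ?thesis
    by (rule connected_set_closed_subset[OF assms(2)]) (use assms in \<open>auto simp: comp_in_def\<close>)
qed

lemma connected_subset_comp_in:
  assumes "connected_set G D" "D \<subseteq> U" "D \<noteq> {}"
  obtains C where "comp_in G U C" "D \<subseteq> C"
proof -
  obtain v where "v \<in> D" using assms by auto
  then obtain C where "comp_in G U C" "v \<in> C" using assms(2) by (meson comp_in_exists subsetD)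
  with comp_in_maximal[OF _ assms(1,2)] \<open>v \<in> D\<close> that show ?thesis by blast
qed

section \<open>Components of induced subgraphs, and disjointedness in terms of vertex sets\<close>

lemma adj_induced: "adj (induced G S) u v \<longleftrightarrow> adj G u v \<and> u \<in> S \<and> v \<in> S"
  by (auto simp: adj_def induced_def edges_def)

lemma verts_induced: "verts (induced G S) = verts G \<inter> S"
  by (simp add: induced_def verts_def)

lemma connected_set_induced:
  assumes "C \<subseteq> S"
  shows "connected_set (induced G S) C \<longleftrightarrow> connected_set G C"
proof -
  have "(\<lambda>x y. x \<in> C \<and> y \<in> C \<and> adj (induced G S) x y) = (\<lambda>x y. x \<in> C \<and> y \<in> C \<and> adj G x y)"
    using assms by (auto simp: adj_induced fun_eq_iff)
  then show ?thesis unfolding connected_set_def by simp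
qed

lemma component_induced: "component (induced G S) C \<longleftrightarrow> comp_in G (verts G \<inter> S) C"
  unfolding component_def comp_in_def
  by (auto simp: verts_induced adj_induced connected_set_induced)

lemma component_del: "component (del G S) C \<longleftrightarrow> comp_in G (verts G - S) C"
  by (simp add: del_def component_induced Int_absorb1)

lemma comp_in_induced: "U \<subseteq> S \<Longrightarrow> comp_in (induced G S) U C \<longleftrightarrow> comp_in G U C"
  unfolding comp_in_def
  by (auto simp: adj_induced connected_set_induced subset_iff)

lemma component_del_induced:
  assumes "X \<subseteq> verts G - S"
  shows "component (del (induced (del G S) X) Q) Y \<longleftrightarrow> comp_in G (X - Q) Y"
proof -
  have "verts (induced (del G S) X) = X"
    using assms by (auto simp: del_def verts_induced)
  then have "component (del (induced (del G S) X) Q) Y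
      \<longleftrightarrow> comp_in (induced (induced G (verts G - S)) X) (X - Q) Y"
    by (simp add: component_del del_def[of G])
  also have "\<dots> \<longleftrightarrow> comp_in G (X - Q) Y"
    using assms by (subst comp_in_induced, blast)+ simp
  finally show ?thesis .
qed

lemma disjointed_iff:
  "disjointed c d G \<beta> \<longleftrightarrow>
     (\<forall>B. (\<forall>i<c. B i \<in> \<beta>) \<longrightarrow>
       (\<forall>X. comp_in G (verts G - (\<Union>i<c. B i)) X \<longrightarrow>
          (\<exists>Q \<subseteq> X. real (card Q) \<le> d \<and>
             (\<forall>Y. comp_in G (X - Q) Y \<longrightarrow>
                (\<exists>i<c. Y \<inter> nbhd G (B i - (\<Union>j<i. B j)) = {})))))"
proof -
  have "component (del (induced (del G (\<Union>i<c. B i)) X) Q) Y \<longleftrightarrow> comp_in G (X - Q) Y"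
    if "comp_in G (verts G - (\<Union>i<c. B i)) X" for B :: "nat \<Rightarrow> 'a set" and X Q Y
    using that by (intro component_del_induced) (auto simp: comp_in_def)
  then show ?thesis unfolding disjointed_def component_del by (simp cong: imp_cong)
qed

lemma disjointedE:
  assumes "disjointed c d G \<beta>" "\<forall>i<c. B i \<in> \<beta>" "comp_in G (verts G - (\<Union>i<c. B i)) X"
  obtains Q where "Q \<subseteq> X" "real (card Q) \<le> d"
    "\<And>Y. comp_in G (X - Q) Y \<Longrightarrow> \<exists>i<c. Y \<inter> nbhd G (B i - (\<Union>j<i. B j)) = {}"
  using assms(1)[unfolded disjointed_iff, rule_format, OF assms(2)[rule_format] assms(3)] by auto

lemma disjointed_mono:
  assumes "disjointed c d G \<beta>" "\<gamma> \<subseteq> \<beta>" "d \<le> e"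
  shows "disjointed c e G \<gamma>"
  unfolding disjointed_def
proof (intro allI impI)
  fix B X
  assume "\<forall>i<c. B i \<in> \<gamma>" and X: "component (del G (\<Union>i<c. B i)) X"
  then have "\<forall>i<c. B i \<in> \<beta>" using assms(2) by auto
  from assms(1)[unfolded disjointed_def, rule_format, OF this[rule_format] X] assms(3)
  show "\<exists>Q\<subseteq>X. real (card Q) \<le> e \<and> (\<forall>Y. component (del (induced (del G (\<Union>i<c. B i)) X) Q) Y \<longrightarrow>
          (\<exists>i<c. Y \<inter> nbhd G (B i - (\<Union>j<i. B j)) = {}))"
    by (meson order_trans)
qed

lemma wf_graph_finite: "wf_graph G \<Longrightarrow> finite (verts G)"
  by (simp add: wf_graph_def)

lemma finite_subset_verts: "wf_graph G \<Longrightarrow> X \<subseteq> verts G \<Longrightarrow> finite X"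
  by (auto simp: wf_graph_def intro: finite_subset)

lemma comp_in_disjoint:
  assumes "comp_in G U C" "comp_in G U D" "C \<inter> D \<noteq> {}"
  shows "C = D"
  using comp_in_maximal[OF assms(1), of D] comp_in_maximal[OF assms(2), of C] assms
  by (auto simp: comp_in_def)

section \<open>Trees and tree decompositions\<close>

text \<open>A set containing \<open>r\<close> grows vertex by vertex. Each new vertex
  \<open>y\<close> brings an edge from the set to \<open>y\<close>, which differs from all earlier
  edges because those stay inside the set.\<close>

lemma connected_card_verts_le:
  assumes wf: "wf_graph T" and conn: "connected_graph T"
  shows "card (verts T) \<le> card (edges T) + 1"
proof (cases "verts T = {}")
  case False
  then obtain r where r: "r \<in> verts T" by auto
  have fin: "finite (verts T)" using wf by (simp add: wf_graph_def)
  then have fE: "finite (edges T)"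
    using wf by (auto simp: wf_graph_def intro: finite_subset[of _ "Pow (verts T)"])
  have "\<exists>A F. r \<in> A \<and> A \<subseteq> verts T \<and> card A = Suc n \<and> F \<subseteq> edges T \<and> \<Union>F \<subseteq> A \<and> card F = n"
    if "n < card (verts T)" for n
    using that
  proof (induction n)
    case 0
    show ?case by (rule exI[of _ "{r}"], rule exI[of _ "{}"]) (use r in auto)
  next
    case (Suc n)
    then obtain A F where AF: "r \<in> A" "A \<subseteq> verts T" "card A = Suc n" "F \<subseteq> edges T" "\<Union>F \<subseteq> A" "card F = n"
      by auto
    have "\<not> verts T \<subseteq> A" using AF Suc.prems by auto
    then obtain x y where xy: "x \<in> A" "y \<in> verts T" "y \<notin> A" "adj T x y"
      using connected_set_closed_subset[OF conn[unfolded connected_graph_def] r \<open>r \<in> A\<close>] by blast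
    have fA: "finite A" "finite F" using AF fin fE finite_subset by blast+
    have "{x,y} \<notin> F" using AF xy by auto
    then have "card (insert {x,y} F) = Suc n" "card (insert y A) = Suc (Suc n)"
      using AF fA xy by simp_all
    moreover have "\<Union>(insert {x,y} F) \<subseteq> insert y A" using AF xy by blast
    moreover have "insert {x,y} F \<subseteq> edges T" using AF xy by (simp add: adj_def)
    ultimately show ?case using AF xy by (meson insertI2 insert_subset)
  qed
  moreover have "card (verts T) - 1 < card (verts T)" using fin False by (simp add: card_gt_0_iff)
  ultimately obtain F where "F \<subseteq> edges T" "card F = card (verts T) - 1" by meson
  then have "card (verts T) - 1 \<le> card (edges T)" using card_mono[OF fE, of F] by simp
  then show ?thesis by simp
qed simp

text \<open>Deleting a tree edge disconnects its ends, because connectivity would need one edge more.\<close>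

lemma tree_edge_bridge:
  assumes T: "is_tree T" and e: "adj T s t"
  shows "\<not> (\<lambda>x y. adj T x y \<and> {x,y} \<noteq> {s,t})\<^sup>*\<^sup>* s t"
proof
  let ?R = "\<lambda>x y. adj T x y \<and> {x,y} \<noteq> {s,t}"
  assume st: "?R\<^sup>*\<^sup>* s t"
  define T' where "T' = (verts T, edges T - {{s,t}})"
  have wf: "wf_graph T" and conn: "connected_graph T" using T by (auto simp: is_tree_def)
  have vT: "verts T' = verts T" and eT: "edges T' = edges T - {{s,t}}"
    by (auto simp: T'_def verts_def edges_def)
  have R: "?R x y \<longleftrightarrow> x \<in> verts T' \<and> y \<in> verts T' \<and> adj T' x y" for x y
    unfolding adj_def eT vT using adj_verts[OF wf] by (auto simp: adj_def)
  have RW: "?R\<^sup>*\<^sup>* = walk_in T' (verts T')" unfolding R ..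
  have "connected_graph T'" unfolding connected_graph_def connected_set_def
  proof (intro ballI)
    fix u v assume "u \<in> verts T'" "v \<in> verts T'"
    then have "walk_in T (verts T) u v"
      using conn by (simp add: connected_graph_def connected_set_def vT)
    then show "walk_in T' (verts T') u v"
    proof (induction rule: rtranclp_induct)
      case (step y z)
      have "walk_in T' (verts T') y z"
      \<comment> \<open>Wherever a walk uses the deleted edge, the assumed detour from
        \<open>s\<close> to \<open>t\<close> replaces it.\<close>
      proof (cases "{y,z} = {s,t}")
        case True
        then show ?thesis using st walk_in_sym[where G = T' and u = s and v = t] unfolding RW
          by (auto simp: doubleton_eq_iff)
      next
        case False
        then have "?R y z" using step by auto
        then show ?thesis unfolding R by (rule r_into_rtranclp)
      qed
      with step show ?case by auto
    qed simp
  qed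
  moreover have "wf_graph T'" using wf by (auto simp: wf_graph_def vT eT)
  ultimately have "card (verts T) \<le> card (edges T') + 1"
    using connected_card_verts_le[of T'] vT by simp
  moreover have "finite (edges T)"
    using wf by (auto simp: wf_graph_def intro: finite_subset[of _ "Pow (verts T)"])
  moreover have "{s,t} \<in> edges T" using e by (simp add: adj_def)
  ultimately have "card (verts T) \<le> card (edges T)"
    unfolding eT by (metis card_Suc_Diff1 Suc_eq_plus1)
  then show False using T by (simp add: is_tree_def)
qed

text \<open>The walk is cut at its last departure from \<open>t\<close>.\<close>

lemma rtranclp_first_step_avoiding:
  assumes "R\<^sup>*\<^sup>* t u" "u \<noteq> t"
  obtains p where "R t p" "(\<lambda>x y. x \<noteq> t \<and> y \<noteq> t \<and> R x y)\<^sup>*\<^sup>* p u"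
proof -
  have "\<exists>p. R t p \<and> (\<lambda>x y. x \<noteq> t \<and> y \<noteq> t \<and> R x y)\<^sup>*\<^sup>* p u"
    using assms
  proof (induction rule: rtranclp_induct)
    case (step y z)
    show ?case
    proof (cases "y = t")
      case True
      with step(2) show ?thesis by blast
    next
      case False
      then obtain p where p: "R t p" "(\<lambda>x y. x \<noteq> t \<and> y \<noteq> t \<and> R x y)\<^sup>*\<^sup>* p y"
        using step.IH by blast
      have "y \<noteq> t \<and> z \<noteq> t \<and> R y z" using False step by blast
      then have "(\<lambda>x y. x \<noteq> t \<and> y \<noteq> t \<and> R x y)\<^sup>*\<^sup>* p z"
        using p(2) by (rule_tac rtranclp.rtrancl_into_rtrancl)
      with p show ?thesis by blast
    qed
  qed simp
  with that show ?thesis by blast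
qed

lemma tree_decomp_adjE:
  assumes "tree_decomp G T bag" "adj G x y"
  obtains u where "u \<in> verts T" "x \<in> bag u" "y \<in> bag u"
proof -
  have "\<forall>e\<in>edges G. \<exists>t\<in>verts T. e \<subseteq> bag t" using assms(1) by (simp add: tree_decomp_def)
  with assms(2) have "\<exists>t\<in>verts T. {x, y} \<subseteq> bag t" unfolding adj_def by (rule bspec[rotated])
  with that show ?thesis by auto
qed

lemma tree_decomp_vertE:
  assumes "tree_decomp G T bag" "x \<in> verts G"
  obtains u where "u \<in> verts T" "x \<in> bag u"
proof -
  have "{t \<in> verts T. x \<in> bag t} \<noteq> {}" using assms by (simp add: tree_decomp_def)
  with that show ?thesis by auto
qed

lemma tree_decomp_connected:
  assumes "tree_decomp G T bag" "x \<in> verts G"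
  shows "connected_set T {t \<in> verts T. x \<in> bag t}"
  using assms by (simp add: tree_decomp_def)

text \<open>The nodes holding a fixed vertex are connected, and adjacent vertices share a bag, so a
  walk in \<open>C\<close> lifts to a walk between nodes.\<close>

lemma connected_set_nodes_meeting:
  assumes td: "tree_decomp G T bag" and C: "connected_set G C" "C \<subseteq> verts G"
  shows "connected_set T {u \<in> verts T. bag u \<inter> C \<noteq> {}}"
proof -
  let ?U = "{u \<in> verts T. bag u \<inter> C \<noteq> {}}"
  have single: "walk_in T ?U u w"
    if "v \<in> C" "u \<in> verts T" "v \<in> bag u" "w \<in> verts T" "v \<in> bag w" for v u w
  proof -
    have "connected_set T {t \<in> verts T. v \<in> bag t}"
      using tree_decomp_connected[OF td] C that by blast
    then have "walk_in T {t \<in> verts T. v \<in> bag t} u w"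
      by (rule connected_setD) (use that in auto)
    then show ?thesis by (rule walk_in_mono) (use that in auto)
  qed
  have "walk_in T ?U u w"
    if x: "x \<in> C" "u \<in> verts T" "x \<in> bag u" and y: "y \<in> C" "w \<in> verts T" "y \<in> bag w" for x y u w
  proof -
    have "walk_in G C x y" using C(1) x(1) y(1) by (rule connected_setD)
    then show ?thesis using y
    proof (induction arbitrary: w rule: rtranclp_induct)
      case base
      then show ?case using single x by blast
    next
      case (step y z)
      then obtain m where m: "m \<in> verts T" "y \<in> bag m" "z \<in> bag m"
        using tree_decomp_adjE[OF td] by blast
      then have "walk_in T ?U u m" using step by blast
      moreover have "walk_in T ?U m w" using single[of z m w] m step by blast
      ultimately show ?case by (rule rtranclp_trans)
    qed
  qed
  then show ?thesis unfolding connected_set_def by blast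
qed

text \<open>Each node \<open>t\<close> points towards the branch of the tree that holds \<open>C t\<close>. A tree has fewer
  edges than nodes, so two adjacent nodes \<open>s\<close> and \<open>t\<close> point at each other; then
  \<open>bag s \<inter> bag t\<close> separates \<open>C s\<close> from \<open>C t\<close>.\<close>

lemma tree_decomp_opposite_nodes:
  assumes td: "tree_decomp G T bag"
    and C: "\<And>t. t \<in> verts T \<Longrightarrow> C t \<noteq> {} \<and> C t \<subseteq> verts G \<and> connected_set G (C t) \<and> C t \<inter> bag t = {}"
  shows "\<exists>s\<in>verts T. \<exists>t\<in>verts T. \<forall>D. D \<subseteq> verts G \<and> connected_set G D \<and> D \<inter> C s \<noteq> {} \<and> D \<inter> C t \<noteq> {} \<longrightarrow>
       D \<inter> bag s \<inter> bag t \<noteq> {}"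
proof -
  have T: "is_tree T" using td by (simp add: tree_decomp_def)
  then have wf: "wf_graph T" and conn: "connected_graph T" by (auto simp: is_tree_def)
  define R where "R a = (\<lambda>x y. x \<noteq> a \<and> y \<noteq> a \<and> adj T x y)" for a
  define U where "U t = {u \<in> verts T. bag u \<inter> C t \<noteq> {}}" for t
  \<comment> \<open>\<open>U t\<close> is connected and avoids \<open>t\<close>, so a single
    neighbour of \<open>t\<close> leads to all of it.\<close>
  have "\<exists>p. adj T t p \<and> (\<forall>u\<in>U t. (R t)\<^sup>*\<^sup>* p u)" if t: "t \<in> verts T" for t
  proof -
    obtain v where v: "v \<in> C t" "v \<in> verts G" using C[OF t] by auto
    then obtain u where u: "u \<in> verts T" "v \<in> bag u" using tree_decomp_vertE[OF td] by blast
    then have uU: "u \<in> U t" using v by (auto simp: U_def)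
    have tU: "t \<notin> U t" using C[OF t] by (auto simp: U_def)
    have "walk_in T (verts T) t u"
      using conn t u by (simp add: connected_graph_def connected_set_def)
    then have "(adj T)\<^sup>*\<^sup>* t u" by (rule mono_rtranclp[rule_format, rotated]) auto
    moreover have "u \<noteq> t" using uU tU by auto
    ultimately obtain p where p: "adj T t p" "(R t)\<^sup>*\<^sup>* p u"
      unfolding R_def by (rule rtranclp_first_step_avoiding)
    have "(R t)\<^sup>*\<^sup>* p w" if "w \<in> U t" for w
    proof -
      have "connected_set T (U t)"
        unfolding U_def using connected_set_nodes_meeting[OF td] C[OF t] by blast
      then have "walk_in T (U t) u w" using uU that by (rule connected_setD)
      then have "(R t)\<^sup>*\<^sup>* u w"
        by (rule mono_rtranclp[rule_format, rotated]) (use tU in \<open>auto simp: R_def\<close>)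
      with p show ?thesis by auto
    qed
    with p show ?thesis by auto
  qed
  then obtain out where out: "\<And>t. t \<in> verts T \<Longrightarrow> adj T t (out t)"
    "\<And>t u. t \<in> verts T \<Longrightarrow> u \<in> U t \<Longrightarrow> (R t)\<^sup>*\<^sup>* (out t) u"
    by metis
  have "\<not> inj_on (\<lambda>t. {t, out t}) (verts T)"
  proof
    assume "inj_on (\<lambda>t. {t, out t}) (verts T)"
    moreover have "(\<lambda>t. {t, out t}) ` verts T \<subseteq> edges T" using out(1) by (auto simp: adj_def)
    moreover have "finite (edges T)"
      using wf by (auto simp: wf_graph_def intro: finite_subset[of _ "Pow (verts T)"])
    ultimately have "card (verts T) \<le> card (edges T)" by (rule card_inj_on_le)
    then show False using T by (simp add: is_tree_def)
  qed
  then obtain s t where st: "s \<in> verts T" "t \<in> verts T" "out s = t" "out t = s"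
    unfolding inj_on_def by (auto simp: doubleton_eq_iff)
  have adj: "adj T s t" using out st by auto
  \<comment> \<open>Otherwise \<open>u\<close> would be joined to both ends of the edge without
    using it.\<close>
  have disj: False if "(R s)\<^sup>*\<^sup>* t u" "(R t)\<^sup>*\<^sup>* s u" for u
  proof -
    let ?E = "\<lambda>x y. adj T x y \<and> {x,y} \<noteq> {s,t}"
    have "?E\<^sup>*\<^sup>* s u"
      using that(2) by (rule mono_rtranclp[rule_format, rotated]) (auto simp: R_def doubleton_eq_iff)
    moreover have "?E\<^sup>*\<^sup>* t u"
      using that(1) by (rule mono_rtranclp[rule_format, rotated]) (auto simp: R_def doubleton_eq_iff)
    moreover have "symp ?E" by (rule sympI) (auto simp: adj_sym insert_commute)
    ultimately have "?E\<^sup>*\<^sup>* s t" by (meson rtranclp_trans symp_rtranclp sympD)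
    with tree_edge_bridge[OF T adj] show False by blast
  qed
  show ?thesis
  proof (rule bexI[OF _ st(1)], rule bexI[OF _ st(2)], intro allI impI)
    fix D assume "D \<subseteq> verts G \<and> connected_set G D \<and> D \<inter> C s \<noteq> {} \<and> D \<inter> C t \<noteq> {}"
    then have D: "D \<subseteq> verts G" "connected_set G D" "D \<inter> C s \<noteq> {}" "D \<inter> C t \<noteq> {}" by auto
    show "D \<inter> bag s \<inter> bag t \<noteq> {}"
    proof
      assume none: "D \<inter> bag s \<inter> bag t = {}"
      obtain a b where ab: "a \<in> D" "a \<in> C s" "b \<in> D" "b \<in> C t" using D by auto
      \<comment> \<open>The vertices all of whose nodes lie on the \<open>t\<close> side of the
        edge. The set \<open>D\<close> starts there in \<open>C s\<close> and, missing
        \<open>bag s \<inter> bag t\<close>, can never leave.\<close>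
      define A where "A = {v. \<forall>u\<in>verts T. v \<in> bag u \<longrightarrow> (R s)\<^sup>*\<^sup>* t u}"
      have "D \<subseteq> A"
      proof (rule connected_set_closed_subset[OF D(2) \<open>a \<in> D\<close>])
        show "a \<in> A" unfolding A_def using out(2)[of s] st ab by (auto simp: U_def)
      next
        fix x y assume xy: "x \<in> A" "x \<in> D" "y \<in> D" "adj G x y"
        then obtain u where u: "u \<in> verts T" "x \<in> bag u" "y \<in> bag u"
          using tree_decomp_adjE[OF td] by blast
        let ?Ty = "{t \<in> verts T. y \<in> bag t}"
        have cy: "connected_set T ?Ty" using tree_decomp_connected[OF td] xy D by blast
        have Ru: "(R s)\<^sup>*\<^sup>* t u" using xy u by (auto simp: A_def)
        have walk: "(R z)\<^sup>*\<^sup>* v w" if "z \<notin> ?Ty" "v \<in> ?Ty" "w \<in> ?Ty" for v w z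
          using connected_setD[OF cy that(2,3)]
          by (rule mono_rtranclp[rule_format, rotated]) (use that(1) in \<open>auto simp: R_def\<close>)
        show "y \<in> A"
        proof (cases "s \<in> ?Ty")
          case False
          then show ?thesis using Ru walk[of s u] u by (auto simp: A_def intro: rtranclp_trans)
        next
          case True
          \<comment> \<open>The nodes of \<open>y\<close> include \<open>s\<close> but not
            \<open>t\<close>, so they reach \<open>u\<close> from \<open>s\<close> without passing
            \<open>t\<close>; this puts \<open>u\<close> on both sides.\<close>
          then have "t \<notin> ?Ty" using none xy by auto
          then have "(R t)\<^sup>*\<^sup>* s u" using walk True u by blast
          then show ?thesis using disj Ru by blast
        qed
      qed
      then have "b \<in> A" using ab by auto
      obtain u where "u \<in> verts T" "b \<in> bag u"
        using tree_decomp_vertE[OF td] D ab by blast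
      then show False using \<open>b \<in> A\<close> disj out(2)[of t u] st ab by (auto simp: U_def A_def)
    qed
  qed
qed

text \<open>The decomposition with the single bag \<open>verts G\<close> shows that some width
  occurs, so the least one is attained.\<close>

lemma treewidth_leE:
  assumes "wf_graph G" "treewidth G \<le> k"
  obtains T bag where "tree_decomp G T bag" "\<And>t. t \<in> verts T \<Longrightarrow> card (bag t) \<le> k + 1"
proof -
  let ?P = "\<lambda>k. \<exists>T bag. tree_decomp G T bag \<and> (\<forall>t\<in>verts T. card (bag t) \<le> k + 1)"
  have "tree_decomp G ({0}, {}) (\<lambda>_. verts G)"
    using assms(1)
    by (auto simp: tree_decomp_def is_tree_def wf_graph_def verts_def edges_def
        connected_graph_def connected_set_def)
  then have "?P (card (verts G))"
    by (intro exI[of _ "({0},{})"] exI[of _ "\<lambda>_. verts G"]) (simp add: verts_def)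
  then have "?P (treewidth G)" unfolding treewidth_def by (rule LeastI)
  then show ?thesis using assms(2) that by (meson add_le_mono1 order_trans)
qed

section \<open>Unions of members of a disjointed covering\<close>

lemma covering_finite: "wf_graph G \<Longrightarrow> covering l G \<beta> \<Longrightarrow> finite \<beta>"
  by (auto simp: covering_def wf_graph_def intro: finite_subset[of _ "Pow (verts G)"])

text \<open>A component of \<open>X - Q\<close>, where \<open>Q\<close> collects the sets obtained for all choices of one
  member from each of the \<open>c\<close> unions, misses one of the unions: otherwise it would touch the
  members through which it is adjacent to the unions.\<close>

lemma disjointed_union_family:
  assumes wf: "wf_graph G" and cov: "covering l G \<beta>" and dis: "disjointed c (real d) G \<beta>"
  shows "disjointed c (real (t ^ c * d)) G (union_family \<beta> t)"
  unfolding disjointed_iff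
proof (intro allI impI)
  fix B X
  assume B: "\<forall>i<c. B i \<in> union_family \<beta> t"
    and X: "comp_in G (verts G - (\<Union>i<c. B i)) X"
  have "\<forall>i<c. \<exists>F. F \<subseteq> \<beta> \<and> card F \<le> t \<and> B i = \<Union>F"
    using B unfolding union_family_def by blast
  then obtain F where F: "\<And>i. i < c \<Longrightarrow> F i \<subseteq> \<beta> \<and> card (F i) \<le> t \<and> B i = \<Union>(F i)"
    by metis
  have finF: "finite (F i)" if "i < c" for i
    using F[OF that] covering_finite[OF wf cov] finite_subset by blast
  define \<Phi> where "\<Phi> = PiE {..<c} F"
  have fin\<Phi>: "finite \<Phi>" unfolding \<Phi>_def by (rule finite_PiE) (use finF in auto)
  have "card \<Phi> = (\<Prod>i<c. card (F i))" unfolding \<Phi>_def by (rule card_PiE) simp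
  also have "\<dots> \<le> (\<Prod>i<c. t)" by (rule prod_mono) (use F in auto)
  finally have card\<Phi>: "card \<Phi> \<le> t ^ c" by simp
  have Xs: "X \<noteq> {}" "X \<subseteq> verts G - (\<Union>i<c. B i)" "connected_set G X"
    using X by (auto simp: comp_in_def)
  have "\<exists>Q. card Q \<le> d \<and> finite Q \<and> (\<forall>Y. connected_set G Y \<and> Y \<noteq> {} \<and> Y \<subseteq> X - Q \<longrightarrow>
      (\<exists>i<c. Y \<inter> nbhd G (\<phi> i - (\<Union>j<i. \<phi> j)) = {}))" if \<phi>: "\<phi> \<in> \<Phi>" for \<phi>
  proof -
    have \<phi>F: "\<phi> i \<in> F i" if "i < c" for i using \<phi> that by (auto simp: \<Phi>_def)
    then have "(\<Union>i<c. \<phi> i) \<subseteq> (\<Union>i<c. B i)" using F by blast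
    then have "X \<subseteq> verts G - (\<Union>i<c. \<phi> i)" using Xs by blast
    \<comment> \<open>Deleting only the chosen members leaves more of \<open>G\<close>, so
      \<open>X\<close> is merely contained in a component there; disjointedness is applied to that
      component.\<close>
    then obtain X' where X': "comp_in G (verts G - (\<Union>i<c. \<phi> i)) X'" "X \<subseteq> X'"
      using connected_subset_comp_in Xs by metis
    have \<phi>\<beta>: "\<forall>i<c. \<phi> i \<in> \<beta>" using \<phi>F F by blast
    obtain Q where Q: "Q \<subseteq> X'" "real (card Q) \<le> real d"
      "\<And>Y. comp_in G (X' - Q) Y \<Longrightarrow> \<exists>i<c. Y \<inter> nbhd G (\<phi> i - (\<Union>j<i. \<phi> j)) = {}"
      using disjointedE[OF dis \<phi>\<beta> X'(1)] by blast
    have "X' \<subseteq> verts G" using X' by (auto simp: comp_in_def)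
    then have "finite Q" using Q(1) finite_subset_verts[OF wf] by blast
    moreover have "\<exists>i<c. Y \<inter> nbhd G (\<phi> i - (\<Union>j<i. \<phi> j)) = {}"
      if Y: "connected_set G Y" "Y \<noteq> {}" "Y \<subseteq> X - Q" for Y
    proof -
      have "Y \<subseteq> X' - Q" using Y X' by blast
      then obtain Y' where "comp_in G (X' - Q) Y'" "Y \<subseteq> Y'"
        by (rule connected_subset_comp_in[OF Y(1) _ Y(2)])
      with Q(3) show ?thesis by blast
    qed
    ultimately show ?thesis using Q(2) by (intro exI[of _ Q]) simp
  qed
  then obtain q where q: "\<And>\<phi>. \<phi> \<in> \<Phi> \<Longrightarrow> card (q \<phi>) \<le> d \<and> finite (q \<phi>)"
    "\<And>\<phi> Y. \<phi> \<in> \<Phi> \<Longrightarrow> connected_set G Y \<Longrightarrow> Y \<noteq> {} \<Longrightarrow> Y \<subseteq> X - q \<phi> \<Longrightarrow>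
      \<exists>i<c. Y \<inter> nbhd G (\<phi> i - (\<Union>j<i. \<phi> j)) = {}"
    by metis
  define Q where "Q = X \<inter> (\<Union>\<phi>\<in>\<Phi>. q \<phi>)"
  have "card Q \<le> card (\<Union>\<phi>\<in>\<Phi>. q \<phi>)"
    unfolding Q_def by (rule card_mono) (use fin\<Phi> q in auto)
  also have "\<dots> \<le> (\<Sum>\<phi>\<in>\<Phi>. card (q \<phi>))" by (rule card_UN_le[OF fin\<Phi>])
  also have "\<dots> \<le> (\<Sum>\<phi>\<in>\<Phi>. d)" by (rule sum_mono) (use q in auto)
  also have "\<dots> \<le> t ^ c * d" using card\<Phi> by simp
  finally have cQ: "card Q \<le> t ^ c * d" .
  have "\<exists>i<c. Y \<inter> nbhd G (B i - (\<Union>j<i. B j)) = {}" if Y: "comp_in G (X - Q) Y" for Y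
  proof (rule ccontr)
    assume neg: "\<not> ?thesis"
    have "\<exists>A. A \<in> F i \<and> Y \<inter> nbhd G (A - (\<Union>j<i. B j)) \<noteq> {}" if i: "i < c" for i
    proof -
      obtain y where y: "y \<in> Y" "y \<in> nbhd G (B i - (\<Union>j<i. B j))" using neg i by blast
      then obtain u where u: "u \<in> B i - (\<Union>j<i. B j)" "adj G u y" "y \<in> verts G"
        by (auto simp: nbhd_def)
      then obtain A where "A \<in> F i" "u \<in> A" using F[OF i] by blast
      moreover have "y \<in> nbhd G (A - (\<Union>j<i. B j))" using u \<open>u \<in> A\<close> by (auto simp: nbhd_def)
      ultimately show ?thesis using y by blast
    qed
    then obtain a where a: "\<And>i. i < c \<Longrightarrow> a i \<in> F i \<and> Y \<inter> nbhd G (a i - (\<Union>j<i. B j)) \<noteq> {}"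
      by metis
    define \<phi> where "\<phi> = restrict a {..<c}"
    have \<phi>: "\<phi> \<in> \<Phi>" using a by (auto simp: \<Phi>_def \<phi>_def)
    have "Y \<subseteq> X - q \<phi>" using Y \<phi> by (auto simp: comp_in_def Q_def)
    then obtain i where i: "i < c" "Y \<inter> nbhd G (\<phi> i - (\<Union>j<i. \<phi> j)) = {}"
      using q(2)[OF \<phi>] Y unfolding comp_in_def by blast
    \<comment> \<open>Subtracting the members \<open>\<phi> j\<close> removes less than subtracting
      the unions \<open>B j\<close>, so a neighbour seen after the larger subtraction is also seen
      after the smaller one.\<close>
    have "\<phi> j \<subseteq> B j" if "j < i" for j using a[of j] F[of j] that i by (auto simp: \<phi>_def)
    then have "nbhd G (a i - (\<Union>j<i. B j)) \<subseteq> nbhd G (\<phi> i - (\<Union>j<i. \<phi> j))"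
      using i by (auto simp: nbhd_def \<phi>_def) blast
    with a[OF i(1)] i(2) show False by blast
  qed
  with cQ show "\<exists>Q\<subseteq>X. real (card Q) \<le> real (t ^ c * d) \<and> (\<forall>Y. comp_in G (X - Q) Y \<longrightarrow>
                 (\<exists>i<c. Y \<inter> nbhd G (B i - (\<Union>j<i. B j)) = {}))"
    by (intro exI[of _ Q]) (auto simp: Q_def simp del: of_nat_mult of_nat_power)
qed

section \<open>Separators\<close>

text \<open>If no \<open>X \<inter> bag t\<close> served, every bag would leave a component with
  more than half of \<open>S\<close>. Any two of these share a vertex \<open>v\<close>; for the
  opposite nodes the connected set \<open>{v}\<close> would then have to meet both bags.\<close>

lemma balanced_separator:
  assumes wf: "wf_graph G" and tw: "treewidth G \<le> k" and X: "X \<subseteq> verts G" and finS: "finite S"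
  shows "\<exists>Z\<subseteq>X. card Z \<le> k + 1 \<and> (\<forall>C. comp_in G (X - Z) C \<longrightarrow> 2 * card (C \<inter> S) \<le> card S)"
proof (rule ccontr)
  assume neg: "\<not> ?thesis"
  obtain T bag where td: "tree_decomp G T bag" and bag: "\<And>t. t \<in> verts T \<Longrightarrow> card (bag t) \<le> k + 1"
    using treewidth_leE[OF wf tw] by blast
  have fin: "finite (bag t)" if "t \<in> verts T" for t
    using td that by (intro finite_subset_verts[OF wf]) (simp add: tree_decomp_def)
  have "\<exists>C. comp_in G (X - bag t) C \<and> card S < 2 * card (C \<inter> S)" if "t \<in> verts T" for t
  proof -
    have "card (X \<inter> bag t) \<le> k + 1"
      using bag[OF that] card_mono[OF fin[OF that], of "X \<inter> bag t"] by simp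
    moreover have "X - X \<inter> bag t = X - bag t" by auto
    ultimately show ?thesis using neg by (metis Int_lower1 not_le_imp_less)
  qed
  then obtain C where C: "\<And>t. t \<in> verts T \<Longrightarrow> comp_in G (X - bag t) (C t) \<and> card S < 2 * card (C t \<inter> S)"
    by metis
  then have avoid: "\<And>t. t \<in> verts T \<Longrightarrow>
      C t \<noteq> {} \<and> C t \<subseteq> verts G \<and> connected_set G (C t) \<and> C t \<inter> bag t = {}"
    using X by (fastforce simp: comp_in_def)
  have "\<exists>s\<in>verts T. \<exists>t\<in>verts T. \<forall>D. D \<subseteq> verts G \<and> connected_set G D \<and>
      D \<inter> C s \<noteq> {} \<and> D \<inter> C t \<noteq> {} \<longrightarrow> D \<inter> bag s \<inter> bag t \<noteq> {}"
    by (rule tree_decomp_opposite_nodes[OF td avoid])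
  then obtain s t where st: "s \<in> verts T" "t \<in> verts T"
    and sep: "\<forall>D. D \<subseteq> verts G \<and> connected_set G D \<and> D \<inter> C s \<noteq> {} \<and> D \<inter> C t \<noteq> {} \<longrightarrow>
       D \<inter> bag s \<inter> bag t \<noteq> {}"
    by blast
  have big: "card S < 2 * card (C s \<inter> S)" "card S < 2 * card (C t \<inter> S)" using C st by auto
  have "C s \<inter> C t \<noteq> {}"
  proof
    assume "C s \<inter> C t = {}"
    then have "card (C s \<inter> S) + card (C t \<inter> S) = card ((C s \<inter> S) \<union> (C t \<inter> S))"
      using finS by (subst card_Un_disjoint) auto
    also have "\<dots> \<le> card S" using finS by (intro card_mono) auto
    finally show False using big by simp
  qed
  then obtain v where v: "v \<in> C s" "v \<in> C t" by auto
  have "C s \<subseteq> X - bag s" using C st by (auto simp: comp_in_def)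
  then show False using sep[rule_format, of "{v}"] v X by (auto simp: connected_set_singleton)
qed

text \<open>One covering member is taken for each vertex of \<open>S\<close>. With \<open>B\<close>
  their union and \<open>S' = B \<inter> X\<close>, this one \<open>B\<close> serves every
  component, since the components of \<open>X - S'\<close> avoid \<open>B\<close>.\<close>

lemma attachment_superset_small:
  assumes wf: "wf_graph G" and cov: "covering l G \<beta>" and S: "S \<subseteq> X" "X \<subseteq> verts G" "card S \<le> m"
  shows "\<exists>S'. S \<subseteq> S' \<and> S' \<subseteq> X \<and> card S' \<le> m * l \<and> (\<forall>X'. comp_in G (X - S') X' \<longrightarrow>
           (\<exists>B\<in>union_family \<beta> m. nbhd G X' \<inter> S' \<subseteq> B \<and> B \<inter> X' = {}))"
proof -
  have "\<Union>\<beta> = verts G" using cov by (simp add: covering_def)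
  then have "\<forall>v\<in>S. \<exists>b\<in>\<beta>. v \<in> b" using S by blast
  then obtain b where b: "\<And>v. v \<in> S \<Longrightarrow> b v \<in> \<beta> \<and> v \<in> b v" by metis
  have finS: "finite S" using S finite_subset_verts[OF wf] by blast
  define B where "B = \<Union>(b ` S)"
  have "card (b ` S) \<le> m" using card_image_le[OF finS, of b] S by simp
  then have B: "B \<in> union_family \<beta> m" using b unfolding union_family_def B_def by blast
  have "B \<subseteq> verts G" using b cov by (auto simp: B_def covering_def)
  then have "finite B" by (rule finite_subset_verts[OF wf])
  then have "card (B \<inter> X) \<le> card B" by (intro card_mono) auto
  also have "\<dots> \<le> (\<Sum>v\<in>S. card (b v))" unfolding B_def by (rule card_UN_le[OF finS])
  also have "\<dots> \<le> (\<Sum>v\<in>S. l)" by (rule sum_mono) (use b cov in \<open>auto simp: covering_def\<close>)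
  also have "\<dots> \<le> m * l" using S by simp
  finally have "card (B \<inter> X) \<le> m * l" .
  moreover have "S \<subseteq> B \<inter> X" using b S by (auto simp: B_def)
  moreover have "nbhd G X' \<inter> (B \<inter> X) \<subseteq> B \<and> B \<inter> X' = {}" if "comp_in G (X - B \<inter> X) X'" for X'
    using that by (auto simp: comp_in_def)
  ultimately show ?thesis using B by (intro exI[of _ "B \<inter> X"]) blast
qed

text \<open>A large \<open>S\<close> is split by balanced separators into pieces that are eventually small enough to
  be covered by few members of \<open>\<beta>\<close>. Every component of the rest then attaches to one piece only.\<close>

lemma attachment_superset:
  "\<exists>g. \<forall>(G :: 'a graph) \<beta> X S. wf_graph G \<longrightarrow> treewidth G \<le> k \<longrightarrow> covering l G \<beta> \<longrightarrow>
     X \<subseteq> verts G \<longrightarrow> S \<subseteq> X \<longrightarrow> card S \<le> n \<longrightarrow>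
     (\<exists>S'. S \<subseteq> S' \<and> S' \<subseteq> X \<and> card S' \<le> g \<and> (\<forall>X'. comp_in G (X - S') X' \<longrightarrow>
        (\<exists>B\<in>union_family \<beta> (2 * (k + 1)). nbhd G X' \<inter> S' \<subseteq> B \<and> B \<inter> X' = {})))"
proof (induction n)
  case 0
  show ?case
    by (intro exI[of _ "2 * (k + 1) * l"] allI impI attachment_superset_small) auto
next
  case (Suc n)
  then obtain g where g: "\<And>(G :: 'a graph) \<beta> X S. wf_graph G \<Longrightarrow> treewidth G \<le> k \<Longrightarrow>
     covering l G \<beta> \<Longrightarrow> X \<subseteq> verts G \<Longrightarrow> S \<subseteq> X \<Longrightarrow> card S \<le> n \<Longrightarrow>
     \<exists>S'. S \<subseteq> S' \<and> S' \<subseteq> X \<and> card S' \<le> g \<and> (\<forall>X'. comp_in G (X - S') X' \<longrightarrow>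
        (\<exists>B\<in>union_family \<beta> (2 * (k + 1)). nbhd G X' \<inter> S' \<subseteq> B \<and> B \<inter> X' = {}))"
    by metis
  show ?case
  \<comment> \<open>The first summand pays for the small case; otherwise there are at most
    \<open>n + 2\<close> pieces, each costing at most \<open>g\<close>.\<close>
  proof (intro exI[of _ "2 * (k + 1) * l + (n + 2) * g"] allI impI)
    fix G :: "'a graph" and \<beta> X S
    assume wf: "wf_graph G" and tw: "treewidth G \<le> k" and cov: "covering l G \<beta>"
      and X: "X \<subseteq> verts G" and S: "S \<subseteq> X" and cS: "card S \<le> Suc n"
    let ?good = "\<lambda>X S'. \<forall>X'. comp_in G (X - S') X' \<longrightarrow>
        (\<exists>B\<in>union_family \<beta> (2 * (k + 1)). nbhd G X' \<inter> S' \<subseteq> B \<and> B \<inter> X' = {})"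
    show "\<exists>S'. S \<subseteq> S' \<and> S' \<subseteq> X \<and> card S' \<le> 2 * (k + 1) * l + (n + 2) * g \<and> ?good X S'"
    proof (cases "card S \<le> 2 * (k + 1)")
      case True
      from attachment_superset_small[OF wf cov S X True] show ?thesis
        by (meson trans_le_add1)
    next
      case False
      have finX: "finite X" by (rule finite_subset_verts[OF wf X])
      then have finS: "finite S" using S by (rule finite_subset[rotated])
      obtain Z where Z: "Z \<subseteq> X" "card Z \<le> k + 1"
        "\<And>C. comp_in G (X - Z) C \<Longrightarrow> 2 * card (C \<inter> S) \<le> card S"
        using balanced_separator[OF wf tw X finS] by blast
      \<comment> \<open>At most \<open>card S\<close> components of \<open>X - Z\<close> meet
        \<open>S\<close>. All others are merged into the one piece \<open>rest\<close>, which keeps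
        the number of pieces bounded.\<close>
      define \<C> where "\<C> = {C. comp_in G (X - Z) C \<and> C \<inter> S \<noteq> {}}"
      define rest where "rest = X - Z - \<Union>\<C>"
      define \<W> where "\<W> = insert rest \<C>"
      have "\<forall>C\<in>\<C>. \<exists>x. x \<in> C \<inter> S" by (auto simp: \<C>_def)
      then obtain pick where pick: "\<And>C. C \<in> \<C> \<Longrightarrow> pick C \<in> C \<inter> S" by metis
      have "inj_on pick \<C>"
      proof (rule inj_onI)
        fix C D assume CD: "C \<in> \<C>" "D \<in> \<C>" "pick C = pick D"
        then have "C \<inter> D \<noteq> {}" using pick[of C] pick[of D] by auto
        then show "C = D" using CD comp_in_disjoint[of G "X - Z" C D] by (simp add: \<C>_def)
      qed
      moreover have "pick ` \<C> \<subseteq> S" using pick by auto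
      ultimately have c\<C>: "card \<C> \<le> card S" and fin\<C>: "finite \<C>"
        using finS by (blast intro: card_inj_on_le inj_on_finite)+
      have fin\<W>: "finite \<W>" using fin\<C> by (simp add: \<W>_def)
      have c\<W>: "card \<W> \<le> n + 2"
        using card_insert_le_m1[of "n + 2" \<C> rest] c\<C> cS by (simp add: \<W>_def)
      have Wsub: "W \<subseteq> X - Z" if "W \<in> \<W>" for W
        using that by (auto simp: \<W>_def rest_def \<C>_def comp_in_def)
      have Wclosed: "v \<in> W" if W_v: "W \<in> \<W>" "u \<in> W" "v \<in> X - Z" "adj G u v" for W u v
      proof (cases "W \<in> \<C>")
        case True
        then show ?thesis using that by (auto simp: \<C>_def comp_in_def)
      next
        case False
        then have W: "W = rest" using that by (simp add: \<W>_def)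
        show ?thesis
        proof (rule ccontr)
          assume "v \<notin> W"
          then obtain C where C: "C \<in> \<C>" "v \<in> C" using W_v(3) W unfolding rest_def by blast
          then have "u \<in> C" using that W adj_sym[OF that(4)]
            by (auto simp: \<C>_def comp_in_def rest_def)
          then show False using C W that by (auto simp: rest_def)
        qed
      qed
      have Wdisj: "W \<inter> W' = {}" if "W \<in> \<W>" "W' \<in> \<W>" "W \<noteq> W'" for W W'
      proof (cases "W = rest \<or> W' = rest")
        case True
        then show ?thesis using that by (auto simp: \<W>_def rest_def)
      next
        case False
        then show ?thesis using that comp_in_disjoint[of G "X - Z" W W'] by (auto simp: \<W>_def \<C>_def)
      qed
      have Wcover: "X - Z \<subseteq> \<Union>\<W>" by (auto simp: \<W>_def rest_def)
      have "rest \<inter> S = {}"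
      proof (rule ccontr)
        assume "rest \<inter> S \<noteq> {}"
        then obtain v where v: "v \<in> rest" "v \<in> S" by auto
        then have "v \<in> X - Z" by (auto simp: rest_def)
        then obtain C where "comp_in G (X - Z) C" "v \<in> C" using comp_in_exists by metis
        then show False using v by (auto simp: rest_def \<C>_def)
      qed
      then have Whalf: "2 * card (W \<inter> S) \<le> card S" if "W \<in> \<W>" for W
        using that Z(3) by (auto simp: \<W>_def \<C>_def)
      \<comment> \<open>The induction hypothesis is applied to the piece together with
        \<open>Z\<close>, because components inside the piece may attach to \<open>Z\<close> as
        well.\<close>
      have "\<exists>S'. W \<inter> S \<union> Z \<subseteq> S' \<and> S' \<subseteq> W \<union> Z \<and> card S' \<le> g \<and> ?good (W \<union> Z) S'"
        if W: "W \<in> \<W>" for W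
      proof (rule g[OF wf tw cov])
        show "W \<union> Z \<subseteq> verts G" using Wsub[OF W] Z X by auto
        show "W \<inter> S \<union> Z \<subseteq> W \<union> Z" by auto
        have "card (W \<inter> S \<union> Z) \<le> card (W \<inter> S) + card Z" by (rule card_Un_le)
        \<comment> \<open>The piece holds at most half of \<open>S\<close>, and \<open>Z\<close> has
          fewer vertices than the other half because \<open>card S\<close> exceeds
          \<open>2 * (k + 1)\<close>; so the set got smaller.\<close>
        moreover have "w \<le> n" if "w \<le> a + z" "2 * a \<le> s" "z \<le> k + 1" "\<not> s \<le> 2 * (k + 1)" "s \<le> Suc n"
          for w a z s :: nat using that by arith
        ultimately show "card (W \<inter> S \<union> Z) \<le> n" using Whalf[OF W] Z(2) False cS by blast
      qed
      then obtain h where h: "\<And>W. W \<in> \<W> \<Longrightarrow> W \<inter> S \<union> Z \<subseteq> h W \<and> h W \<subseteq> W \<union> Z \<and> card (h W) \<le> g"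
        and hgood: "\<And>W. W \<in> \<W> \<Longrightarrow> ?good (W \<union> Z) (h W)"
        by metis
      define S' where "S' = (\<Union>W\<in>\<W>. h W)"
      \<comment> \<open>Pieces are disjoint and every \<open>h W\<close> contains all of
        \<open>Z\<close>, so the other sets \<open>h W'\<close> add nothing inside
        \<open>W \<union> Z\<close>.\<close>
      have hS': "h W = S' \<inter> (W \<union> Z)" if W: "W \<in> \<W>" for W
      proof
        show "h W \<subseteq> S' \<inter> (W \<union> Z)" using W h by (auto simp: S'_def)
        show "S' \<inter> (W \<union> Z) \<subseteq> h W"
        proof
          fix v assume v: "v \<in> S' \<inter> (W \<union> Z)"
          show "v \<in> h W"
          proof (cases "v \<in> Z")
            case True
            then show ?thesis using h[OF W] by auto
          next
            case False
            obtain W' where W': "W' \<in> \<W>" "v \<in> h W'" using v by (auto simp: S'_def)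
            then have "v \<in> W'" using h[OF W'(1)] False by auto
            then have "W' = W" using Wdisj[OF W'(1) W] v False by auto
            then show ?thesis using W' by simp
          qed
        qed
      qed
      have restW: "rest \<in> \<W>" by (simp add: \<W>_def)
      then have ZS': "Z \<subseteq> S'" using h by (auto simp: S'_def)
      have "S \<subseteq> S'"
      proof
        fix v assume "v \<in> S"
        show "v \<in> S'"
        proof (cases "v \<in> Z")
          case False
          then obtain W where "W \<in> \<W>" "v \<in> W" using \<open>v \<in> S\<close> S Wcover by auto
          then show ?thesis using h[of W] \<open>v \<in> S\<close> unfolding S'_def by blast
        qed (use ZS' in auto)
      qed
      moreover have "S' \<subseteq> X" using h Wsub Z unfolding S'_def by blast
      moreover have "card S' \<le> 2 * (k + 1) * l + (n + 2) * g"
      proof -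
        have "card S' \<le> (\<Sum>W\<in>\<W>. card (h W))" unfolding S'_def by (rule card_UN_le[OF fin\<W>])
        also have "\<dots> \<le> (\<Sum>W\<in>\<W>. g)" by (rule sum_mono) (use h in auto)
        also have "\<dots> \<le> (n + 2) * g" using c\<W> by (simp only: sum_constant mult_le_mono1 of_nat_id)
        finally show ?thesis by simp
      qed
      moreover have "?good X S'"
      proof (intro allI impI)
        fix X' assume X': "comp_in G (X - S') X'"
        then obtain v where v: "v \<in> X'" by (auto simp: comp_in_def)
        have X'sub: "X' \<subseteq> X - S'" and X'conn: "connected_set G X'" using X' by (auto simp: comp_in_def)
        then obtain W where W: "W \<in> \<W>" "v \<in> W" using v ZS' Wcover by blast
        \<comment> \<open>\<open>X'\<close> avoids \<open>Z\<close>, so it cannot leave its piece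
          and is a component of what \<open>h W\<close> leaves there.\<close>
        have "X' \<subseteq> W"
          by (rule connected_set_closed_subset[OF X'conn v W(2)])
            (use Wclosed[OF W(1)] X'sub ZS' in blast)
        then have "comp_in G (W \<union> Z - h W) X'"
          unfolding comp_in_def hS'[OF W(1)]
          using X' X'sub Wsub[OF W(1)] Z ZS' unfolding comp_in_def by blast
        then obtain B where B: "B \<in> union_family \<beta> (2 * (k + 1))" "nbhd G X' \<inter> h W \<subseteq> B" "B \<inter> X' = {}"
          using hgood[OF W(1)] by blast
        \<comment> \<open>Neighbours of \<open>X'\<close> in \<open>X\<close> lie in
          \<open>W \<union> Z\<close>, where \<open>S'\<close> and \<open>h W\<close> agree, so the
          \<open>B\<close> found for the piece still works.\<close>
        have "nbhd G X' \<inter> S' \<subseteq> h W"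
        proof
          fix y assume y: "y \<in> nbhd G X' \<inter> S'"
          then obtain x where x: "x \<in> X'" "adj G x y" by (auto simp: nbhd_def)
          have "y \<in> X" using y \<open>S' \<subseteq> X\<close> by auto
          then have "y \<in> W \<union> Z" using Wclosed[OF W(1), of x y] x \<open>X' \<subseteq> W\<close> by auto
          then show "y \<in> h W" using hS'[OF W(1)] y by auto
        qed
        with B show "\<exists>B\<in>union_family \<beta> (2 * (k + 1)). nbhd G X' \<inter> S' \<subseteq> B \<and> B \<inter> X' = {}" by blast
      qed
      ultimately show ?thesis by blast
    qed
  qed
qed

section \<open>From partitions to disjointedness\<close>

lemma H_partition_part:
  assumes "H_partition G H P" "v \<in> verts G"
  obtains x where "x \<in> verts H" "v \<in> P x"
  using assms unfolding H_partition_def by blast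

lemma H_partition_unique:
  assumes "H_partition G H P" "x \<in> verts H" "y \<in> verts H" "v \<in> P x" "v \<in> P y"
  shows "x = y"
  using assms unfolding H_partition_def by blast

lemma H_partition_adj:
  assumes "H_partition G H P" "x \<in> verts H" "y \<in> verts H" "v \<in> P x" "w \<in> P y" "adj G v w"
  shows "x = y \<or> adj H x y"
  using assms unfolding H_partition_def by blast

text \<open>Consecutive vertices of a walk lie in equal or adjacent parts, so the walk projects to
  \<open>H\<close>.\<close>

lemma connected_set_parts_meeting:
  assumes HP: "H_partition G H P" and C: "connected_set G C" "C \<subseteq> verts G"
  shows "connected_set H {x \<in> verts H. P x \<inter> C \<noteq> {}}"
proof -
  let ?U = "{x \<in> verts H. P x \<inter> C \<noteq> {}}"
  have "walk_in H ?U x y"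
    if x: "u \<in> C" "x \<in> verts H" "u \<in> P x" and y: "v \<in> C" "y \<in> verts H" "v \<in> P y" for u v x y
  proof -
    have "walk_in G C u v" using C(1) x(1) y(1) by (rule connected_setD)
    then show ?thesis using y
    proof (induction arbitrary: y rule: rtranclp_induct)
      case base
      then show ?case using H_partition_unique[OF HP _ _ x(3)] x by blast
    next
      case (step v w)
      then obtain z where z: "z \<in> verts H" "v \<in> P z"
        using H_partition_part[OF HP] C by blast
      have "walk_in H ?U x z" using step z by blast
      moreover have "z = y \<or> (z \<in> ?U \<and> y \<in> ?U \<and> adj H z y)"
        using H_partition_adj[OF HP z(1) _ z(2)] step z by blast
      ultimately show ?case by (metis (no_types, lifting) rtranclp.rtrancl_into_rtrancl)
    qed
  qed
  then show ?thesis unfolding connected_set_def by blast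
qed

text \<open>For some bag \<open>K\<close> of a tree decomposition of \<open>H\<close> the parts in \<open>K\<close> can serve as \<open>Q\<close>.
  Otherwise every bag \<open>K\<close> has a bad component \<open>Y K\<close>, and there are two bags whose intersection
  separates their bad components. It contains the \<open>c\<close> deleted parts and another one, so the two
  bags are equal; but \<open>Y K\<close> depends on the bag only.\<close>

lemma H_partition_disjointed:
  assumes wf: "wf_graph G" and wfH: "wf_graph H" and tw: "treewidth H \<le> c"
    and HP: "H_partition G H P" and w: "\<And>x. x \<in> verts H \<Longrightarrow> card (P x) \<le> w"
  shows "disjointed c (real ((c + 1) * w)) G (P ` verts H)"
  unfolding disjointed_iff
proof (intro allI impI)
  fix B X
  assume B: "\<forall>i<c. B i \<in> P ` verts H" and X: "comp_in G (verts G - (\<Union>i<c. B i)) X"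
  let ?N = "\<lambda>i. nbhd G (B i - (\<Union>j<i. B j))"
  show "\<exists>Q\<subseteq>X. real (card Q) \<le> real ((c + 1) * w) \<and>
      (\<forall>Y. comp_in G (X - Q) Y \<longrightarrow> (\<exists>i<c. Y \<inter> ?N i = {}))"
  proof (cases "\<exists>i<c. B i - (\<Union>j<i. B j) = {}")
    case True
    then obtain i where "i < c" "B i - (\<Union>j<i. B j) = {}" by auto
    then have "i < c" "?N i = {}" by (simp_all only:) (simp add: nbhd_def)
    then show ?thesis by (intro exI[of _ "{}"]) auto
  next
    \<comment> \<open>Every \<open>B i\<close> now has a vertex outside the earlier ones. Hence the
      nodes \<open>x i\<close> are distinct, as the final count requires.\<close>
    case new: False
    have X_sub: "X \<subseteq> verts G - (\<Union>i<c. B i)" and X_conn: "connected_set G X" and "X \<noteq> {}"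
      using X by (auto simp: comp_in_def)
    have "\<forall>i<c. \<exists>x. x \<in> verts H \<and> B i = P x" using B by blast
    then obtain x where x: "\<And>i. i < c \<Longrightarrow> x i \<in> verts H \<and> B i = P (x i)" by metis
    have x_neq: "x i \<noteq> x j" if "i < j" "j < c" for i j
    proof
      assume "x i = x j"
      then have "B i = B j" using x that by simp
      then have "B j - (\<Union>m<j. B m) = {}" using that(1) by blast
      with new that show False by blast
    qed
    have "inj_on x {..<c}"
    proof (rule inj_onI)
      fix i j assume "i \<in> {..<c}" "j \<in> {..<c}" "x i = x j"
      then show "i = j" using x_neq[of i j] x_neq[of j i] by (cases i j rule: linorder_cases) auto
    qed
    then have card_x: "card (x ` {..<c}) = c" by (simp add: card_image)
    obtain T bag where td: "tree_decomp H T bag"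
      and bag: "\<And>t. t \<in> verts T \<Longrightarrow> card (bag t) \<le> c + 1"
      using treewidth_leE[OF wfH tw] by blast
    have bagH: "bag t \<subseteq> verts H" if "t \<in> verts T" for t using td that by (simp add: tree_decomp_def)
    have finbag: "finite (bag t)" if "t \<in> verts T" for t
      using bagH[OF that] by (rule finite_subset_verts[OF wfH])
    define q where "q K = X \<inter> (\<Union>y\<in>K. P y)" for K
    have q: "q (bag t) \<subseteq> X \<and> real (card (q (bag t))) \<le> real ((c + 1) * w)" if t: "t \<in> verts T" for t
    proof -
      have "(\<Union>y\<in>bag t. P y) \<subseteq> verts G" using bagH[OF t] HP by (auto simp: H_partition_def)
      then have "card (q (bag t)) \<le> card (\<Union>y\<in>bag t. P y)"
        unfolding q_def by (intro card_mono finite_subset_verts[OF wf]) auto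
      also have "\<dots> \<le> (\<Sum>y\<in>bag t. card (P y))" by (rule card_UN_le[OF finbag[OF t]])
      also have "\<dots> \<le> (\<Sum>y\<in>bag t. w)" by (rule sum_mono) (use w bagH[OF t] in auto)
      also have "\<dots> \<le> (c + 1) * w" using bag[OF t] by (simp only: sum_constant mult_le_mono1 of_nat_id)
      finally show ?thesis unfolding of_nat_le_iff by (auto simp: q_def)
    qed
    define bad where "bad K Y \<longleftrightarrow> comp_in G (X - q K) Y \<and> (\<forall>i<c. Y \<inter> ?N i \<noteq> {})" for K Y
    define Y where "Y K = (SOME Y. bad K Y)" for K
    show ?thesis
    proof (rule ccontr)
      assume neg: "\<not> ?thesis"
      have bad: "bad (bag t) (Y (bag t))" if t: "t \<in> verts T" for t
      proof -
        have "\<not> (\<forall>Y. comp_in G (X - q (bag t)) Y \<longrightarrow> (\<exists>i<c. Y \<inter> ?N i = {}))"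
          using neg q[OF t] by (elim contrapos_nn) (intro exI[of _ "q (bag t)"], simp)
        then have "\<exists>Y. bad (bag t) Y" by (simp add: bad_def)
        then show ?thesis unfolding Y_def by (rule someI_ex)
      qed
      define C where "C t = {y \<in> verts H. P y \<inter> Y (bag t) \<noteq> {}}" for t
      have Y: "Y (bag t) \<noteq> {}" "Y (bag t) \<subseteq> X - q (bag t)" "connected_set G (Y (bag t))"
        "\<And>i. i < c \<Longrightarrow> Y (bag t) \<inter> ?N i \<noteq> {}" if "t \<in> verts T" for t
        using bad[OF that] by (auto simp: bad_def comp_in_def)
      have C: "C t \<noteq> {} \<and> C t \<subseteq> verts H \<and> connected_set H (C t) \<and> C t \<inter> bag t = {}"
        if t: "t \<in> verts T" for t
      proof (intro conjI)
        have "Y (bag t) \<subseteq> verts G" using Y(2)[OF t] X_sub by blast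
        then show "connected_set H (C t)"
          unfolding C_def by (rule connected_set_parts_meeting[OF HP Y(3)[OF t]])
        obtain v where v: "v \<in> Y (bag t)" "v \<in> verts G"
          using Y(1)[OF t] \<open>Y (bag t) \<subseteq> verts G\<close> by blast
        obtain y where "y \<in> verts H" "v \<in> P y" using H_partition_part[OF HP v(2)] .
        then show "C t \<noteq> {}" using v by (auto simp: C_def)
        show "C t \<inter> bag t = {}" using Y(2)[OF t] by (auto simp: C_def q_def)
      qed (auto simp: C_def)
      have "\<exists>s\<in>verts T. \<exists>t\<in>verts T. \<forall>D. D \<subseteq> verts H \<and> connected_set H D \<and>
          D \<inter> C s \<noteq> {} \<and> D \<inter> C t \<noteq> {} \<longrightarrow> D \<inter> bag s \<inter> bag t \<noteq> {}"
        by (rule tree_decomp_opposite_nodes[OF td C])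
      then obtain s t where st: "s \<in> verts T" "t \<in> verts T"
        and sep: "\<forall>D. D \<subseteq> verts H \<and> connected_set H D \<and> D \<inter> C s \<noteq> {} \<and> D \<inter> C t \<noteq> {} \<longrightarrow>
          D \<inter> bag s \<inter> bag t \<noteq> {}"
        by blast
      have nbr: "\<exists>y\<in>C r. adj H (x i) y" if i: "i < c" and r: "r \<in> verts T" for i r
      proof -
        obtain v where v: "v \<in> Y (bag r)" "v \<in> ?N i" using Y(4)[OF r i] by blast
        then obtain u where u: "u \<in> B i" "adj G u v" "v \<in> verts G" by (auto simp: nbhd_def)
        obtain y where y: "y \<in> verts H" "v \<in> P y" using H_partition_part[OF HP u(3)] .
        have "v \<notin> B i" using Y(2)[OF r] X_sub v(1) i by blast
        then have "x i \<noteq> y" using y x[OF i] by blast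
        then have "adj H (x i) y"
          using H_partition_adj[OF HP _ y(1) _ y(2) u(2)] x[OF i] u(1) by blast
        then show ?thesis using y v by (auto simp: C_def)
      qed
      \<comment> \<open>The set \<open>{x i} \<union> C s \<union> C t\<close> is connected and
        hence meets \<open>bag s \<inter> bag t\<close>. As \<open>C s\<close> avoids
        \<open>bag s\<close> and \<open>C t\<close> avoids \<open>bag t\<close>, only
        \<open>x i\<close> can lie there.\<close>
      have "x i \<in> bag s \<inter> bag t" if i: "i < c" for i
      proof -
        obtain a b where ab: "a \<in> C s" "adj H (x i) a" "b \<in> C t" "adj H (x i) b"
          using nbr[OF i] st by meson
        have "connected_set H ({x i} \<union> C s)"
          using connected_set_Un[OF connected_set_singleton _ _ ab(1)] C[OF st(1)] ab(2) by blast
        then have "connected_set H ({x i} \<union> C s \<union> C t)"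
          using connected_set_Un[OF _ _ _ ab(3)] C[OF st(2)] ab(4) by blast
        then have "({x i} \<union> C s \<union> C t) \<inter> bag s \<inter> bag t \<noteq> {}"
          using sep[rule_format, of "{x i} \<union> C s \<union> C t"] C[OF st(1)] C[OF st(2)] x[OF i] ab(1,3)
          by blast
        then show ?thesis using C[OF st(1)] C[OF st(2)] by blast
      qed
      then have x_sub: "x ` {..<c} \<subseteq> bag s \<inter> bag t" by auto
      \<comment> \<open>The nodes whose parts meet \<open>X\<close> form a connected set containing
        \<open>C s\<close> and \<open>C t\<close>, so one of them lies in both bags. Its part meets
        \<open>X\<close>, so it is none of the \<open>x i\<close>.\<close>
      let ?D = "{y \<in> verts H. P y \<inter> X \<noteq> {}}"
      have "C r \<subseteq> ?D" if "r \<in> verts T" for r using Y(2)[OF that] by (auto simp: C_def)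
      then have "C s \<subseteq> ?D" "C t \<subseteq> ?D" using st by simp_all
      then have "?D \<inter> C s = C s" "?D \<inter> C t = C t" by (simp_all only: Int_absorb1)
      then have "?D \<inter> C s \<noteq> {}" "?D \<inter> C t \<noteq> {}" using C[OF st(1)] C[OF st(2)] by simp_all
      moreover have "connected_set H ?D"
        using X_sub by (intro connected_set_parts_meeting[OF HP X_conn]) auto
      moreover have "?D \<subseteq> verts H" by auto
      ultimately have "?D \<inter> bag s \<inter> bag t \<noteq> {}" by (intro sep[rule_format] conjI)
      then obtain z where z: "z \<in> bag s \<inter> bag t" "P z \<inter> X \<noteq> {}" by auto
      have "z \<notin> x ` {..<c}"
      proof
        assume "z \<in> x ` {..<c}"
        then obtain i where "i < c" "P z = B i" using x by auto
        then show False using z(2) X_sub by blast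
      qed
      then have "c + 1 = card (insert z (x ` {..<c}))" using card_x by simp
      also have "\<dots> \<le> card (bag s \<inter> bag t)"
        using finbag st x_sub z(1) by (intro card_mono) auto
      finally have "c + 1 \<le> card (bag s \<inter> bag t)" .
      then have "bag s \<inter> bag t = bag r" if "r \<in> {s, t}" for r
        using that bag st finbag by (intro card_seteq) (auto intro: order_trans)
      then have "bag s = bag t" by (metis insertI1 insert_commute)
      then have "C s = C t" by (simp add: C_def)
      \<comment> \<open>A single common node is already a connected set meeting both, so it would
        lie in \<open>bag s\<close>, which \<open>C s\<close> avoids.\<close>
      then obtain y where y: "y \<in> C s" "y \<in> C t" using C[OF st(1)] by blast
      then have "{y} \<inter> bag s \<inter> bag t \<noteq> {}"
        using C[OF st(1)] by (intro sep[rule_format] conjI connected_set_singleton) auto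
      then show False using y C[OF st(1)] by blast
    qed
  qed
qed

section \<open>From disjointedness to partitions\<close>

text \<open>The tree has node set \<open>{..<n}\<close>, and node \<open>t\<close> is where the vertex \<open>t\<close> first appears.\<close>

lemma treewidth_le_parent_bags:
  fixes H :: "nat graph"
  assumes n: "0 < n" and vH: "verts H = {..<n}"
    and bag: "\<And>t. t < n \<Longrightarrow> t \<in> bag t \<and> bag t \<subseteq> {..t} \<and> card (bag t) \<le> c + 1"
    and par: "\<And>t. 0 < t \<Longrightarrow> t < n \<Longrightarrow> par t < t \<and> bag t - {t} \<subseteq> bag (par t)"
    and edges: "\<And>e. e \<in> edges H \<Longrightarrow> \<exists>t<n. e \<subseteq> bag t"
  shows "treewidth H \<le> c"
proof -
  define T where "T = ({..<n}, (\<lambda>t. {t, par t}) ` {0<..<n})"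
  have vT: "verts T = {..<n}" and eT: "edges T = (\<lambda>t. {t, par t}) ` {0<..<n}"
    by (simp_all add: T_def verts_def edges_def)
  have adjT: "adj T (par t) t" if "0 < t" "t < n" for t
    using that by (auto simp: adj_def eT insert_commute)
  have "inj_on (\<lambda>t. {t, par t}) {0<..<n}"
  proof (rule inj_onI)
    fix s t assume st: "s \<in> {0<..<n}" "t \<in> {0<..<n}" "{s, par s} = {t, par t}"
    then have "par s < s" "par t < t" using par by auto
    with st(3) show "s = t" by (auto simp: doubleton_eq_iff)
  qed
  then have "card (edges T) = n - 1" unfolding eT by (subst card_image) auto
  then have "card (edges T) + 1 = card (verts T)" using n vT by simp
  moreover have "wf_graph T"
    unfolding wf_graph_def vT eT
  proof (intro conjI ballI; (elim imageE)?)
    fix e t assume "e = {t, par t}" "t \<in> {0<..<n}"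
    moreover have "par t < t" using par calculation by auto
    ultimately show "e \<subseteq> {..<n}" "card e = 2" by auto
  qed simp
  moreover have "connected_graph T"
    unfolding connected_graph_def vT
  proof (rule connected_setI_root)
    fix t assume "t \<in> {..<n}"
    then show "walk_in T {..<n} 0 t"
    proof (induction t rule: less_induct)
      case (less t)
      show ?case
      proof (cases "t = 0")
        case False
        then have "par t < t" using less par by simp
        then have "walk_in T {..<n} 0 (par t)" using less by simp
        moreover have "par t \<in> {..<n} \<and> t \<in> {..<n} \<and> adj T (par t) t"
          using adjT False less \<open>par t < t\<close> by simp
        ultimately show ?thesis by (rule rtranclp.rtrancl_into_rtrancl)
      qed simp
    qed
  qed
  ultimately have "is_tree T" using n by (auto simp: is_tree_def vT)
  \<comment> \<open>Passing from a node to its parent keeps \<open>v\<close> in the bag and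
    decreases the node, until node \<open>v\<close> is reached.\<close>
  moreover have "connected_set T {t \<in> verts T. v \<in> bag t}" for v
  proof (rule connected_setI_root)
    let ?U = "{t \<in> verts T. v \<in> bag t}"
    fix t assume "t \<in> ?U"
    then show "walk_in T ?U v t"
    proof (induction t rule: less_induct)
      case (less t)
      show ?case
      proof (cases "t = v")
        case False
        have t: "t < n" "v \<in> bag t" using less by (auto simp: vT)
        then have "v < t" using bag[of t] False by auto
        then have p: "par t < t" "v \<in> bag (par t)" using par[of t] t False by auto
        then have "walk_in T ?U v (par t)" using less t by (simp add: vT)
        moreover have "par t \<in> ?U \<and> t \<in> ?U \<and> adj T (par t) t"
          using p t adjT \<open>v < t\<close> by (simp add: vT)
        ultimately show ?thesis by (rule rtranclp.rtrancl_into_rtrancl)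
      qed simp
    qed
  qed
  moreover have "bag t \<subseteq> {..<n}" if "t < n" for t using bag[OF that] that by auto
  moreover have "{t \<in> verts T. v \<in> bag t} \<noteq> {}" if "v < n" for v using bag[OF that] that by (auto simp: vT)
  moreover have "\<exists>t\<in>verts T. e \<subseteq> bag t" if "e \<in> edges H" for e using edges[OF that] by (auto simp: vT)
  ultimately have "tree_decomp H T bag"
    unfolding tree_decomp_def by (simp add: vH vT)
  then show ?thesis
    unfolding treewidth_def using bag vT by (intro Least_le exI[of _ T] exI[of _ bag]) auto
qed

section \<open>Partial partitions and their extension by one part\<close>

text \<open>\<open>K\<close> is the bag to which the component \<open>X\<close> of the not yet partitioned vertices is attached.
  A part \<open>P (s i)\<close> in it may be larger than the members of \<open>\<gamma>\<close>, but \<open>X\<close> sees it only through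
  the member \<open>B i\<close>.\<close>

definition anchored ::
  "nat \<Rightarrow> 'a graph \<Rightarrow> 'a set set \<Rightarrow> (nat \<Rightarrow> 'a set) \<Rightarrow> nat set \<Rightarrow> 'a set \<Rightarrow> bool" where
  "anchored c G \<gamma> P K X \<longleftrightarrow> (\<exists>s B.
     (\<forall>i<c. s i \<in> K \<and> B i \<in> \<gamma> \<and> B i \<inter> X = {} \<and> nbhd G X \<inter> P (s i) \<subseteq> B i - (\<Union>j<i. B j)) \<and>
     nbhd G X \<subseteq> X \<union> (\<Union>i<c. P (s i)))"

text \<open>\<open>H\<close> is not recorded; it will be the graph joining two nodes that share a
  bag. Nodes are numbered in order of creation, \<open>par\<close> is the parent map of the tree,
  and the last clause is the invariant that lets each remaining component be continued below some
  node \<open>p\<close>.\<close>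

definition partial_H_partition ::
  "nat \<Rightarrow> nat \<Rightarrow> 'a graph \<Rightarrow> 'a set set \<Rightarrow> nat \<Rightarrow> (nat \<Rightarrow> 'a set) \<Rightarrow> (nat \<Rightarrow> nat set) \<Rightarrow> (nat \<Rightarrow> nat) \<Rightarrow> bool"
  where
  "partial_H_partition c w G \<gamma> n P bag par \<longleftrightarrow> 0 < n \<and>
     (\<forall>t<n. t \<in> bag t \<and> bag t \<subseteq> {..t} \<and> card (bag t) \<le> c + 1) \<and>
     (\<forall>t<n. 0 < t \<longrightarrow> par t < t \<and> bag t - {t} \<subseteq> bag (par t)) \<and>
     (\<forall>t<n. P t \<subseteq> verts G \<and> card (P t) \<le> w) \<and>
     (\<forall>t<n. \<forall>u<n. t \<noteq> u \<longrightarrow> P t \<inter> P u = {}) \<and>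
     (\<forall>t<n. \<forall>u<n. \<forall>x\<in>P t. \<forall>y\<in>P u. adj G x y \<longrightarrow> (\<exists>r<n. {t, u} \<subseteq> bag r)) \<and>
     (\<forall>X. comp_in G (verts G - (\<Union>t<n. P t)) X \<longrightarrow> (\<exists>p<n. anchored c G \<gamma> P (bag p) X))"

lemma partial_H_partition_adj:
  assumes "partial_H_partition c w G \<gamma> n P bag par"
    and "t < n" "u < n" "x \<in> P t" "y \<in> P u" "adj G x y"
  shows "\<exists>r<n. {t, u} \<subseteq> bag r"
proof -
  have "\<forall>t<n. \<forall>u<n. \<forall>x\<in>P t. \<forall>y\<in>P u. adj G x y \<longrightarrow> (\<exists>r<n. {t, u} \<subseteq> bag r)"
    using assms(1) unfolding partial_H_partition_def by (elim conjE)
  with assms(2-) show ?thesis by blast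
qed

lemma partial_H_partition_Union:
  "partial_H_partition c w G \<gamma> n P bag par \<Longrightarrow> (\<Union>t<n. P t) \<subseteq> verts G"
  unfolding partial_H_partition_def by (intro UN_least) simp

lemma nbhd_mono: "A \<subseteq> B \<Longrightarrow> nbhd G A \<subseteq> nbhd G B"
  by (auto simp: nbhd_def)

text \<open>A new part changes \<open>P\<close> only at a node outside the old bags, so components
  untouched by the step stay anchored.\<close>

lemma anchored_cong:
  assumes "anchored c G \<gamma> P K X" and P: "\<And>t. t \<in> K \<Longrightarrow> P' t = P t"
  shows "anchored c G \<gamma> P' K X"
proof -
  obtain s B where sB:
      "\<forall>i<c. s i \<in> K \<and> B i \<in> \<gamma> \<and> B i \<inter> X = {} \<and> nbhd G X \<inter> P (s i) \<subseteq> B i - (\<Union>j<i. B j)"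
    and nX: "nbhd G X \<subseteq> X \<union> (\<Union>i<c. P (s i))"
    using assms(1)[unfolded anchored_def] by (elim exE conjE)
  have Ps: "P' (s i) = P (s i)" if "i < c" for i using P sB that by blast
  then have "(\<Union>i<c. P' (s i)) = (\<Union>i<c. P (s i))" by simp
  with nX sB Ps show ?thesis
    unfolding anchored_def by (intro exI[of _ s] exI[of _ B]) simp
qed

text \<open>The start is one empty part. A component has no outside neighbours yet, so the same
  empty part can fill all \<open>c\<close> anchor positions.\<close>

lemma partial_H_partition_init:
  assumes "{} \<in> \<gamma>"
  shows "partial_H_partition c w G \<gamma> 1 (\<lambda>_. {}) (\<lambda>_. {0}) (\<lambda>_. 0)"
proof -
  have "nbhd G X \<subseteq> X" if "comp_in G (verts G) X" for X
    using that by (auto simp: comp_in_def nbhd_def)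
  then have "anchored c G \<gamma> (\<lambda>_. {}) {0} X" if "comp_in G (verts G) X" for X
    unfolding anchored_def using that assms
    by (intro exI[of _ "\<lambda>_. 0"] exI[of _ "\<lambda>_. {}"]) auto
  then show ?thesis unfolding partial_H_partition_def by auto
qed

text \<open>The component \<open>X\<close> loses the anchor \<open>i\<close> that the smaller component \<open>X'\<close> does not see, and
  the new part takes its place.\<close>

lemma anchored_step:
  assumes s: "\<And>i. i < c \<Longrightarrow> s i \<in> K" "\<And>i. i < c \<Longrightarrow> B i \<in> \<gamma>" "\<And>i. i < c \<Longrightarrow> B i \<inter> X = {}"
    and sB: "\<And>i. i < c \<Longrightarrow> nbhd G X \<inter> P (s i) \<subseteq> B i - (\<Union>j<i. B j)"
    and nX: "nbhd G X \<subseteq> X \<union> (\<Union>i<c. P (s i))"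
    and P: "\<And>t. t \<in> K \<Longrightarrow> P' t = P t" "P' n \<subseteq> X"
    and X': "comp_in G (X - P' n) X'"
    and i: "i < c" "X' \<inter> nbhd G (B i - (\<Union>j<i. B j)) = {}" and XG: "X \<subseteq> verts G"
    and A: "A \<in> \<gamma>" "nbhd G X' \<inter> P' n \<subseteq> A" "A \<inter> X' = {}"
  shows "anchored c G \<gamma> P' (insert n (s ` {..<c})) X'"
proof -
  have X'X: "X' \<subseteq> X - P' n" using X' by (simp add: comp_in_def)
  then have nX': "nbhd G X' \<subseteq> nbhd G X" by (intro nbhd_mono) auto
  have Ps: "P' (s j) = P (s j)" if "j < c" for j using P(1) s(1)[OF that] .
  have miss: "nbhd G X' \<inter> P (s i) = {}"
  proof (rule ccontr)
    assume "nbhd G X' \<inter> P (s i) \<noteq> {}"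
    then obtain v u where v: "v \<in> nbhd G X'" "v \<in> P (s i)" "u \<in> X'" "adj G u v"
      by (auto simp: nbhd_def)
    then have "v \<in> B i - (\<Union>j<i. B j)" using sB[OF i(1)] nX' by blast
    moreover have "u \<in> verts G" using v X'X XG by blast
    ultimately have "u \<in> nbhd G (B i - (\<Union>j<i. B j))"
      using adj_sym[OF v(4)] unfolding nbhd_def by blast
    then show False using v i(2) by blast
  qed
  \<comment> \<open>\<open>\<sigma>\<close> runs through the old indices other than \<open>i\<close>
    in increasing order; the new part comes last, at index \<open>c - 1\<close>.\<close>
  define \<sigma> where "\<sigma> j = (if j < i then j else Suc j)" for j
  define s' where "s' j = (if Suc j = c then n else s (\<sigma> j))" for j
  define B' where "B' j = (if Suc j = c then A else B (\<sigma> j))" for j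
  have \<sigma>: "\<sigma> j < c" if "j < c" "Suc j \<noteq> c" for j using that by (auto simp: \<sigma>_def)
  have \<sigma>_mono: "\<sigma> j < \<sigma> m" if "j < m" for j m using that by (auto simp: \<sigma>_def)
  have nbhd_sub: "nbhd G X' \<subseteq> X' \<union> (\<Union>j<c. P' (s' j))"
  proof
    fix v assume v: "v \<in> nbhd G X'"
    then consider "v \<in> X" | m where "m < c" "v \<in> P (s m)" using nX nX' by blast
    then show "v \<in> X' \<union> (\<Union>j<c. P' (s' j))"
    proof cases
      case 1
      show ?thesis
      proof (cases "v \<in> P' n")
        case True
        then have "v \<in> P' (s' (c - 1))" "c - 1 < c" using i(1) by (auto simp: s'_def)
        then show ?thesis by blast
      next
        case False
        then show ?thesis using 1 v X' by (auto simp: nbhd_def comp_in_def)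
      qed
    next
      case 2
      have "m \<noteq> i" using miss v 2 by blast
      define j where "j = (if m < i then m else m - 1)"
      have "j < c" "Suc j \<noteq> c" "\<sigma> j = m"
        using \<open>m \<noteq> i\<close> 2(1) i(1) by (auto simp: j_def \<sigma>_def)
      then have "v \<in> P' (s' j)" using 2 Ps by (simp add: s'_def)
      then show ?thesis using \<open>j < c\<close> by blast
    qed
  qed
  have "s' j \<in> insert n (s ` {..<c}) \<and> B' j \<in> \<gamma> \<and> B' j \<inter> X' = {} \<and>
      nbhd G X' \<inter> P' (s' j) \<subseteq> B' j - (\<Union>m<j. B' m)" if j: "j < c" for j
  proof (cases "Suc j = c")
    case True
    \<comment> \<open>The earlier \<open>B' m\<close> avoid \<open>X\<close>, which contains the new
      part, so in the last position the subtraction takes nothing from it.\<close>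
    have "B' m \<inter> X = {}" if "m < j" for m
      using s(3)[OF \<sigma>, of m] that True by (simp add: B'_def)
    then have "nbhd G X' \<inter> P' n \<subseteq> A - (\<Union>m<j. B' m)" using A P(2) by blast
    then show ?thesis using True A by (simp add: s'_def B'_def)
  next
    case False
    note \<sigma>j = \<sigma>[OF j False]
    \<comment> \<open>The order is preserved, so what is subtracted at position \<open>j\<close> was
      already subtracted at \<open>\<sigma> j\<close>.\<close>
    have "B' m \<subseteq> (\<Union>l<\<sigma> j. B l)" if "m < j" for m
      using \<sigma>_mono[OF that] that j by (auto simp: B'_def)
    then have "(\<Union>m<j. B' m) \<subseteq> (\<Union>l<\<sigma> j. B l)" by blast
    then have "nbhd G X' \<inter> P (s (\<sigma> j)) \<subseteq> B (\<sigma> j) - (\<Union>m<j. B' m)"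
      using sB[OF \<sigma>j] nX' by blast
    moreover have "B (\<sigma> j) \<inter> X' = {}" using s(3)[OF \<sigma>j] X'X by blast
    ultimately show ?thesis using False s(2)[OF \<sigma>j] \<sigma>j Ps by (simp add: s'_def B'_def)
  qed
  with nbhd_sub show ?thesis unfolding anchored_def by blast
qed

text \<open>For one component \<open>X\<close>, \<open>dis\<close> applied to its anchors gives
  \<open>Q\<close>, and \<open>att\<close> enlarges \<open>Q\<close> to the new part
  \<open>S\<close>. Each component of \<open>X - S\<close> lies in a component of
  \<open>X - Q\<close>, hence loses an anchor and has room for \<open>S\<close> among its
  \<open>c\<close> anchors.\<close>

lemma partial_H_partition_step:
  assumes wf: "wf_graph G" and dis: "disjointed c (real d) G \<gamma>"
    and att: "\<forall>X S. X \<subseteq> verts G \<longrightarrow> S \<subseteq> X \<longrightarrow> card S \<le> d + 1 \<longrightarrow>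
      (\<exists>S'. S \<subseteq> S' \<and> S' \<subseteq> X \<and> card S' \<le> w \<and> (\<forall>X'. comp_in G (X - S') X' \<longrightarrow>
        (\<exists>A\<in>\<gamma>. nbhd G X' \<inter> S' \<subseteq> A \<and> A \<inter> X' = {})))"
    and part: "partial_H_partition c w G \<gamma> n P bag par"
    and unc: "verts G - (\<Union>t<n. P t) \<noteq> {}"
  shows "\<exists>P' bag' par'. partial_H_partition c w G \<gamma> (Suc n) P' bag' par' \<and>
      verts G - (\<Union>t<Suc n. P' t) \<subset> verts G - (\<Union>t<n. P t)"
proof -
  define U where "U = verts G - (\<Union>t<n. P t)"
  have n: "0 < n"
    and bag: "\<And>t. t < n \<Longrightarrow> t \<in> bag t \<and> bag t \<subseteq> {..t} \<and> card (bag t) \<le> c + 1"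
    and par: "\<And>t. t < n \<Longrightarrow> 0 < t \<Longrightarrow> par t < t \<and> bag t - {t} \<subseteq> bag (par t)"
    and PG: "\<And>t. t < n \<Longrightarrow> P t \<subseteq> verts G \<and> card (P t) \<le> w"
    and disj: "\<And>t u. t < n \<Longrightarrow> u < n \<Longrightarrow> t \<noteq> u \<Longrightarrow> P t \<inter> P u = {}"
    and anch: "\<And>X. comp_in G U X \<Longrightarrow> \<exists>p<n. anchored c G \<gamma> P (bag p) X"
    using part unfolding partial_H_partition_def U_def by simp_all
  note edge = partial_H_partition_adj[OF part]
  obtain z X where X: "comp_in G U X" "z \<in> X" using unc comp_in_exists[of _ U G] U_def by blast
  then have XU: "X \<subseteq> U" and X_conn: "connected_set G X" and "X \<noteq> {}"
    and X_closed: "\<And>u v. u \<in> X \<Longrightarrow> v \<in> U \<Longrightarrow> adj G u v \<Longrightarrow> v \<in> X"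
    by (auto simp: comp_in_def)
  have XG: "X \<subseteq> verts G" using XU U_def by auto
  obtain p where p: "p < n" "anchored c G \<gamma> P (bag p) X" using anch[OF X(1)] by blast
  from p(2)[unfolded anchored_def] obtain s B where sB_all:
      "\<forall>i<c. s i \<in> bag p \<and> B i \<in> \<gamma> \<and> B i \<inter> X = {} \<and> nbhd G X \<inter> P (s i) \<subseteq> B i - (\<Union>j<i. B j)"
    and nX: "nbhd G X \<subseteq> X \<union> (\<Union>i<c. P (s i))"
    by (elim exE conjE)
  then have s: "\<And>i. i < c \<Longrightarrow> s i \<in> bag p" "\<And>i. i < c \<Longrightarrow> B i \<in> \<gamma>"
      "\<And>i. i < c \<Longrightarrow> B i \<inter> X = {}"
    and sB: "\<And>i. i < c \<Longrightarrow> nbhd G X \<inter> P (s i) \<subseteq> B i - (\<Union>j<i. B j)"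
    by simp_all
  have bag_lt: "t < n" if "t \<in> bag p" for t using bag[OF p(1)] p(1) that by auto
  \<comment> \<open>Outside neighbours of \<open>X\<close> lie in the parts \<open>P (s i)\<close>
    and there in \<open>B i\<close>. So deleting the sets \<open>B i\<close> isolates
    \<open>X\<close> although the parts may be larger.\<close>
  have "comp_in G (verts G - (\<Union>i<c. B i)) X"
    unfolding comp_in_def
  proof (intro conjI ballI impI)
    show "X \<subseteq> verts G - (\<Union>i<c. B i)" using XG s(3) by blast
    fix u v assume uv: "u \<in> X" "v \<in> verts G - (\<Union>i<c. B i)" "adj G u v"
    then have "v \<in> nbhd G X" by (auto simp: nbhd_def)
    then show "v \<in> X" using nX sB uv(2) by blast
  qed fact+
  then obtain Q where Q: "Q \<subseteq> X" "real (card Q) \<le> real d"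
    and Qmiss: "\<And>Y. comp_in G (X - Q) Y \<Longrightarrow> \<exists>i<c. Y \<inter> nbhd G (B i - (\<Union>j<i. B j)) = {}"
    using disjointedE[OF dis, of B] s(2) by blast
  \<comment> \<open>The vertex \<open>z\<close> makes the new part nonempty, so that the uncovered
    set shrinks; it accounts for the \<open>+ 1\<close> in \<open>att\<close>.\<close>
  have "card (insert z Q) \<le> d + 1"
    using Q finite_subset_verts[OF wf, of Q] XG by (simp add: card_insert_if)
  then obtain S where S: "insert z Q \<subseteq> S" "S \<subseteq> X" "card S \<le> w"
    and Satt: "\<And>X'. comp_in G (X - S) X' \<Longrightarrow> \<exists>A\<in>\<gamma>. nbhd G X' \<inter> S \<subseteq> A \<and> A \<inter> X' = {}"
    using att[rule_format, OF XG, of "insert z Q"] Q(1) X(2) by blast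
  define P' where "P' = P(n := S)"
  \<comment> \<open>The new bag holds the new node and all anchors of \<open>X\<close>; these lie in
    the bag of \<open>p\<close>, which becomes the parent.\<close>
  define bag' where "bag' = bag(n := insert n (s ` {..<c}))"
  define par' where "par' = par(n := p)"
  have old: "P' t = P t" "bag' t = bag t" "par' t = par t" if "t < n" for t
    using that by (auto simp: P'_def bag'_def par'_def)
  have new: "P' n = S" "bag' n = insert n (s ` {..<c})" "par' n = p"
    by (auto simp: P'_def bag'_def par'_def)
  have "(\<Union>t<n. P' t) = (\<Union>t<n. P t)" by (intro SUP_cong) (simp_all add: old)
  then have U': "verts G - (\<Union>t<Suc n. P' t) = U - S"
    by (auto simp: lessThan_Suc new U_def)
  have SU: "S \<subseteq> U" using S XU by auto
  have "card (s ` {..<c}) \<le> c" using card_image_le[of "{..<c}" s] by simp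
  then have card_new: "card (insert n (s ` {..<c})) \<le> c + 1"
    using card_insert_le_m1[of "c + 1" "s ` {..<c}" n] by simp
  \<comment> \<open>A vertex of an old part adjacent to \<open>S\<close> is an outside neighbour of
    \<open>X\<close> and so lies in an anchor part.\<close>
  have edge_new: "{n, t} \<subseteq> bag' n" if "t < n" "x \<in> P t" "y \<in> S" "adj G y x" for t x y
  proof -
    have "x \<in> nbhd G X" using that S PG[OF that(1)] by (auto simp: nbhd_def)
    moreover have "x \<notin> X" using that XU by (auto simp: U_def)
    ultimately obtain i where i: "i < c" "x \<in> P (s i)" using nX by blast
    then have "s i = t" using disj[OF bag_lt[OF s(1)[OF i(1)]] that(1)] that(2) by blast
    then show ?thesis using i new by auto
  qed
  have "\<exists>p<Suc n. anchored c G \<gamma> P' (bag' p) X'" if X': "comp_in G (U - S) X'" for X'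
  proof -
    have X'_conn: "connected_set G X'" and X'_sub: "X' \<subseteq> U - S" and X'_ne: "X' \<noteq> {}"
      and X'_closed: "\<And>u v. u \<in> X' \<Longrightarrow> v \<in> U - S \<Longrightarrow> adj G u v \<Longrightarrow> v \<in> X'"
      using X' by (auto simp: comp_in_def)
    show ?thesis
    proof (cases "X' \<inter> X = {}")
      case True
      \<comment> \<open>Missing \<open>X\<close>, the set \<open>X'\<close> is not adjacent to
        \<open>S\<close> and was already a component of \<open>U\<close>; its old anchors still
        serve.\<close>
      have "v \<in> X'" if "u \<in> X'" "v \<in> U" "adj G u v" for u v
      proof -
        have "v \<notin> X" using X_closed[OF _ _ adj_sym[OF that(3)]] that X'_sub True by blast
        then show ?thesis using X'_closed that S by blast
      qed
      then have "comp_in G U X'"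
        unfolding comp_in_def using X'_conn X'_sub X'_ne by blast
      then obtain r where r: "r < n" "anchored c G \<gamma> P (bag r) X'" using anch by blast
      have "t < n" if "t \<in> bag r" for t using bag[OF r(1)] r(1) that by auto
      then have "anchored c G \<gamma> P' (bag' r) X'"
        using anchored_cong[OF r(2), of P'] old r(1) by simp
      then show ?thesis using r(1) less_Suc_eq by blast
    next
      case False
      then have X'X: "X' \<subseteq> X" using comp_in_maximal[OF X(1) X'_conn] X'_sub by blast
      then have "comp_in G (X - S) X'"
        using X' XU unfolding comp_in_def by blast
      then obtain A where A: "A \<in> \<gamma>" "nbhd G X' \<inter> S \<subseteq> A" "A \<inter> X' = {}" using Satt by blast
      have "X' \<subseteq> X - Q" using X'X X'_sub S(1) by blast
      then obtain Y where Y: "comp_in G (X - Q) Y" "X' \<subseteq> Y"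
        using connected_subset_comp_in[OF X'_conn _ X'_ne] by metis
      obtain i where "i < c" "Y \<inter> nbhd G (B i - (\<Union>j<i. B j)) = {}" using Qmiss[OF Y(1)] by blast
      then have i: "i < c" "X' \<inter> nbhd G (B i - (\<Union>j<i. B j)) = {}" using Y(2) by blast+
      have "anchored c G \<gamma> P' (insert n (s ` {..<c})) X'"
        by (rule anchored_step[where X = X and P = P and K = "bag p" and A = A, OF s sB nX])
          (use old(1) bag_lt new(1) S \<open>comp_in G (X - S) X'\<close> i XG A in auto)
      then show ?thesis using new(2) by (metis lessI)
    qed
  qed
  then have "partial_H_partition c w G \<gamma> (Suc n) P' bag' par'"
    unfolding partial_H_partition_def U'
  proof (intro conjI allI impI ballI)
    fix t assume t: "t < Suc n"
    show "t \<in> bag' t" "card (bag' t) \<le> c + 1"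
      using t bag[of t] old(2)[of t] new(2) card_new by (auto simp: less_Suc_eq)
    show "bag' t \<subseteq> {..t}"
      using t bag[of t] old(2)[of t] new(2) bag_lt[OF s(1)] by (force simp: less_Suc_eq)
    show "P' t \<subseteq> verts G" "card (P' t) \<le> w"
      using t PG[of t] old(1)[of t] new(1) S XG by (auto simp: less_Suc_eq)
    assume "0 < t"
    then show "par' t < t" "bag' t - {t} \<subseteq> bag' (par' t)"
      using t par[of t] old[of t] old(2)[of "par t"] new p(1) old(2)[OF p(1)] s(1)
      by (auto simp: less_Suc_eq)
  next
    fix t u assume "t < Suc n" "u < Suc n" "t \<noteq> u"
    then show "P' t \<inter> P' u = {}"
      using disj[of t u] old(1) new(1) SU unfolding U_def less_Suc_eq by auto
  next
    fix t u x y assume tu: "t < Suc n" "u < Suc n" and xy: "x \<in> P' t" "y \<in> P' u" "adj G x y"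
    consider "t < n" "u < n" | "t = n" "u = n" | "t = n" "u < n" | "t < n" "u = n"
      using tu by linarith
    then show "\<exists>r<Suc n. {t, u} \<subseteq> bag' r"
    proof cases
      case 1
      then obtain r where "r < n" "{t, u} \<subseteq> bag r" using edge[of t u x y] xy old(1) by auto
      then show ?thesis using old(2) less_Suc_eq by blast
    next
      case 2
      then show ?thesis using new by blast
    next
      case 3
      then show ?thesis using edge_new[of u y x] xy old(1) new(1) by blast
    next
      case 4
      then show ?thesis using edge_new[of t x y] xy old(1) new(1) adj_sym[OF xy(3)] by blast
    qed
  qed auto
  moreover have "U - S \<subset> U" using S(1) SU by blast
  ultimately show ?thesis using U' U_def by metis
qed

lemma partial_H_partition_complete:
  assumes wf: "wf_graph G" and dis: "disjointed c (real d) G \<gamma>"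
    and att: "\<forall>X S. X \<subseteq> verts G \<longrightarrow> S \<subseteq> X \<longrightarrow> card S \<le> d + 1 \<longrightarrow>
      (\<exists>S'. S \<subseteq> S' \<and> S' \<subseteq> X \<and> card S' \<le> w \<and> (\<forall>X'. comp_in G (X - S') X' \<longrightarrow>
        (\<exists>A\<in>\<gamma>. nbhd G X' \<inter> S' \<subseteq> A \<and> A \<inter> X' = {})))"
    and part: "partial_H_partition c w G \<gamma> n P bag par"
  shows "\<exists>n P bag par. partial_H_partition c w G \<gamma> n P bag par \<and> (\<Union>t<n. P t) = verts G"
  using part
proof (induction "card (verts G - (\<Union>t<n. P t))" arbitrary: n P bag par rule: less_induct)
  case less
  show ?case
  proof (cases "verts G - (\<Union>t<n. P t) = {}")
    case True
    then have "(\<Union>t<n. P t) = verts G"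
      using partial_H_partition_Union[OF less.prems] by blast
    with less.prems show ?thesis by blast
  next
    case False
    obtain P' bag' par' where new: "partial_H_partition c w G \<gamma> (Suc n) P' bag' par'"
      "verts G - (\<Union>t<Suc n. P' t) \<subset> verts G - (\<Union>t<n. P t)"
      using partial_H_partition_step[OF wf dis att less.prems False] by (elim exE conjE)
    have "card (verts G - (\<Union>t<Suc n. P' t)) < card (verts G - (\<Union>t<n. P t))"
      using new(2) wf by (intro psubset_card_mono) (auto simp: wf_graph_def)
    from less.hyps[OF this new(1)] show ?thesis .
  qed
qed

section \<open>Partition width and tree-partition-width\<close>

lemma partition_width_le_iff:
  assumes "finite (verts H)"
  shows "partition_width H P \<le> w \<longleftrightarrow> (\<forall>x\<in>verts H. card (P x) \<le> w)"
proof -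
  have "{card (P x) | x. x \<in> verts H} = (\<lambda>x. card (P x)) ` verts H" by auto
  then show ?thesis using assms by (simp add: partition_width_def)
qed

text \<open>Making every bag a clique yields \<open>H\<close>: the bags then form a tree
  decomposition of it, and adjacent vertices of \<open>G\<close> lie in parts that share a
  bag.\<close>

lemma tpw_le:
  assumes part: "partial_H_partition c w G \<gamma> n P bag par" and cov: "(\<Union>t<n. P t) = verts G"
  shows "tpw c G \<le> w"
proof -
  define H :: "nat graph" where "H = ({..<n}, {{t, u} | t u. t \<noteq> u \<and> (\<exists>r<n. {t, u} \<subseteq> bag r)})"
  have vH: "verts H = {..<n}" and eH: "edges H = {{t, u} | t u. t \<noteq> u \<and> (\<exists>r<n. {t, u} \<subseteq> bag r)}"
    by (simp_all add: H_def verts_def edges_def)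
  have bag: "\<And>t. t < n \<Longrightarrow> t \<in> bag t \<and> bag t \<subseteq> {..t} \<and> card (bag t) \<le> c + 1"
    and n: "0 < n" and par: "\<And>t. 0 < t \<Longrightarrow> t < n \<Longrightarrow> par t < t \<and> bag t - {t} \<subseteq> bag (par t)"
    and disj: "\<And>t u. t < n \<Longrightarrow> u < n \<Longrightarrow> t \<noteq> u \<Longrightarrow> P t \<inter> P u = {}"
    and w: "\<And>t. t < n \<Longrightarrow> card (P t) \<le> w"
    using part unfolding partial_H_partition_def by simp_all
  note edge = partial_H_partition_adj[OF part]
  have bag_lt: "bag r \<subseteq> {..<n}" if "r < n" for r using bag[OF that] that by auto
  have wfH: "wf_graph H"
    unfolding wf_graph_def vH eH using bag_lt by (auto simp: card_2_iff)
  have twH: "treewidth H \<le> c"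
    using treewidth_le_parent_bags[OF n vH bag par] unfolding eH by blast
  have HP: "H_partition G H P"
    unfolding H_partition_def vH
  proof (intro conjI ballI impI)
    fix t u x y assume "t \<in> {..<n}" "u \<in> {..<n}" "x \<in> P t" "y \<in> P u" "adj G x y"
    then have "\<exists>r<n. {t, u} \<subseteq> bag r" using edge[of t u x y] by simp
    then show "t = u \<or> adj H t u" unfolding adj_def eH by blast
  qed (use cov disj in auto)
  have "tpw c G \<le> partition_width H P"
    unfolding tpw_def using wfH twH HP by (intro Least_le) blast
  also have "\<dots> \<le> w" using w by (subst partition_width_le_iff) (auto simp: vH)
  finally show ?thesis .
qed

text \<open>The one-vertex \<open>H\<close> with the part \<open>verts G\<close> shows that some
  width occurs, so the minimum is attained.\<close>

lemma tpw_leE: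
  assumes wf: "wf_graph G" and "tpw c G \<le> w"
  obtains H :: "nat graph" and P where "wf_graph H" "treewidth H \<le> c" "H_partition G H P"
    "\<And>x. x \<in> verts H \<Longrightarrow> card (P x) \<le> w"
proof -
  let ?ok = "\<lambda>w. \<exists>(H :: nat graph) P. wf_graph H \<and> treewidth H \<le> c \<and> H_partition G H P \<and>
    partition_width H P = w"
  let ?H = "({0}, {}) :: nat graph"
  have vH: "verts ?H = {0}" and eH: "edges ?H = {}" by (simp_all add: verts_def edges_def)
  have "wf_graph ?H" by (simp add: wf_graph_def vH eH)
  moreover have "treewidth ?H \<le> c"
    by (rule treewidth_le_parent_bags[of 1 _ "\<lambda>_. {0}"]) (auto simp: vH eH)
  moreover have "H_partition G ?H (\<lambda>_. verts G)" by (auto simp: H_partition_def vH)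
  ultimately have "?ok (partition_width ?H (\<lambda>_. verts G))" by blast
  then have "?ok (tpw c G)" unfolding tpw_def by (rule LeastI)
  then obtain H :: "nat graph" and P where HP: "wf_graph H" "treewidth H \<le> c" "H_partition G H P"
    "partition_width H P = tpw c G"
    by blast
  moreover have "\<forall>x\<in>verts H. card (P x) \<le> w"
    using partition_width_le_iff[OF wf_graph_finite[OF HP(1)], of P w] HP(4) assms(2) by simp
  ultimately show ?thesis using that by blast
qed

section \<open>The equivalences\<close>

lemma tpw_imp_disjointed_lpartition:
  assumes wf: "wf_graph G" and tpw: "tpw c G \<le> w"
  shows "\<exists>\<beta>. lpartition w G \<beta> \<and> disjointed c (real ((c + 1) * w)) G \<beta>"
proof -
  obtain H :: "nat graph" and P where HP: "wf_graph H" "treewidth H \<le> c" "H_partition G H P"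
    "\<And>x. x \<in> verts H \<Longrightarrow> card (P x) \<le> w"
    using tpw_leE[OF assms] by blast
  have "\<Union>(P ` verts H) = verts G" using HP(3) by (simp add: H_partition_def)
  \<comment> \<open>Several nodes may have empty parts, which become one member of the family;
    disjointness is therefore claimed for distinct sets, not for distinct nodes.\<close>
  moreover have "P x \<inter> P y = {}" if "x \<in> verts H" "y \<in> verts H" "P x \<noteq> P y" for x y
    using H_partition_unique[OF HP(3) that(1,2)] that(3) by blast
  ultimately have "lpartition w G (P ` verts H)"
    using HP(4) by (auto simp: lpartition_def covering_def)
  then show ?thesis using H_partition_disjointed[OF wf HP] by blast
qed

text \<open>The number \<open>t\<close> of members in an attachment depends on \<open>k\<close>
  only. It is fixed first, then the constant \<open>e\<close> for unions of \<open>t\<close>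
  members, then the part size \<open>g\<close> for sets of size \<open>e + 1\<close>; so no bound
  depends on itself.\<close>

lemma disjointed_covering_imp_tpw:
  "\<exists>w. \<forall>(G :: 'a graph) \<beta>. wf_graph G \<longrightarrow> treewidth G \<le> k \<longrightarrow> covering l G \<beta> \<longrightarrow>
     disjointed c (real d) G \<beta> \<longrightarrow> tpw c G \<le> w"
proof -
  define t where "t = 2 * (k + 1)"
  define e where "e = t ^ c * d"
  obtain g where g: "\<And>(G :: 'a graph) \<beta> X S. wf_graph G \<Longrightarrow> treewidth G \<le> k \<Longrightarrow>
     covering l G \<beta> \<Longrightarrow> X \<subseteq> verts G \<Longrightarrow> S \<subseteq> X \<Longrightarrow> card S \<le> e + 1 \<Longrightarrow>
     \<exists>S'. S \<subseteq> S' \<and> S' \<subseteq> X \<and> card S' \<le> g \<and> (\<forall>X'. comp_in G (X - S') X' \<longrightarrow>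
        (\<exists>A\<in>union_family \<beta> t. nbhd G X' \<inter> S' \<subseteq> A \<and> A \<inter> X' = {}))"
    using attachment_superset[of k l "e + 1"] unfolding t_def by metis
  have "tpw c G \<le> g"
    if G: "wf_graph G" "treewidth G \<le> k" "covering l G \<beta>" "disjointed c (real d) G \<beta>"
    for G :: "'a graph" and \<beta>
  proof -
    have "{} \<in> union_family \<beta> t"
      unfolding union_family_def by (intro CollectI exI[of _ "{}"]) simp
    then have "partial_H_partition c g G (union_family \<beta> t) 1 (\<lambda>_. {}) (\<lambda>_. {0}) (\<lambda>_. 0)"
      by (rule partial_H_partition_init)
    moreover have "\<forall>X S. X \<subseteq> verts G \<longrightarrow> S \<subseteq> X \<longrightarrow> card S \<le> t ^ c * d + 1 \<longrightarrow>
      (\<exists>S'. S \<subseteq> S' \<and> S' \<subseteq> X \<and> card S' \<le> g \<and> (\<forall>X'. comp_in G (X - S') X' \<longrightarrow>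
        (\<exists>A\<in>union_family \<beta> t. nbhd G X' \<inter> S' \<subseteq> A \<and> A \<inter> X' = {})))"
      unfolding e_def[symmetric] by (intro allI impI g[OF G(1-3)])
    ultimately have "\<exists>n P bag par. partial_H_partition c g G (union_family \<beta> t) n P bag par \<and>
        (\<Union>i<n. P i) = verts G"
      by (rule partial_H_partition_complete[OF G(1) disjointed_union_family[OF G(1,3,4)], rotated])
    then
    show ?thesis by (elim exE conjE) (rule tpw_le)
  qed
  then show ?thesis by blast
qed

lemma disjointed_imp_f_disjointed:
  assumes "wf_graph G" "covering l G \<beta>" "disjointed c (real d) G \<beta>"
  shows "f_disjointed c (\<lambda>t. real (t ^ c * d)) G \<beta>"
  unfolding f_disjointed_def using disjointed_union_family[OF assms] by blast

text \<open>The case \<open>t = 1\<close> suffices, since each member is a union of one member.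
  Rounding up and adding 1 gives a positive natural constant.\<close>

lemma f_disjointed_imp_disjointed:
  assumes "f_disjointed c f G \<beta>"
  shows "disjointed c (real (nat \<lceil>f 1\<rceil> + 1)) G \<beta>"
proof (rule disjointed_mono)
  show "disjointed c (f 1) G (union_family \<beta> 1)" using assms by (simp add: f_disjointed_def)
  show "\<beta> \<subseteq> union_family \<beta> 1"
  proof
    fix B assume "B \<in> \<beta>"
    then show "B \<in> union_family \<beta> 1"
      unfolding union_family_def by (intro CollectI exI[of _ "{B}"]) simp
  qed
  show "f 1 \<le> real (nat \<lceil>f 1\<rceil> + 1)" by linarith
qed

theorem theorem3p2:
  fixes c :: nat and \<G> :: "'a graph set"
  assumes cls: "graph_class \<G>"
    and btw: "\<exists>k. \<forall>G\<in>\<G>. treewidth G \<le> k"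
  shows "((\<exists>w. \<forall>G\<in>\<G>. tpw c G \<le> w) \<longleftrightarrow>
           (\<exists>d l. d \<ge> 1 \<and> l \<ge> 1 \<and> (\<forall>G\<in>\<G>. \<exists>\<beta>. lpartition l G \<beta> \<and> disjointed c (real d) G \<beta>)))
       \<and> ((\<exists>d l. d \<ge> 1 \<and> l \<ge> 1 \<and> (\<forall>G\<in>\<G>. \<exists>\<beta>. lpartition l G \<beta> \<and> disjointed c (real d) G \<beta>)) \<longleftrightarrow>
           (\<exists>d l. d \<ge> 1 \<and> l \<ge> 1 \<and> (\<forall>G\<in>\<G>. \<exists>\<beta>. covering l G \<beta> \<and> disjointed c (real d) G \<beta>)))
       \<and> ((\<exists>d l. d \<ge> 1 \<and> l \<ge> 1 \<and> (\<forall>G\<in>\<G>. \<exists>\<beta>. covering l G \<beta> \<and> disjointed c (real d) G \<beta>)) \<longleftrightarrow>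
           (\<exists>l (f :: nat \<Rightarrow> real). l \<ge> 1 \<and> (\<forall>t\<ge>1. f t > 0) \<and>
              (\<forall>G\<in>\<G>. \<exists>\<beta>. lpartition l G \<beta> \<and> f_disjointed c f G \<beta>)))
       \<and> ((\<exists>l (f :: nat \<Rightarrow> real). l \<ge> 1 \<and> (\<forall>t\<ge>1. f t > 0) \<and>
              (\<forall>G\<in>\<G>. \<exists>\<beta>. lpartition l G \<beta> \<and> f_disjointed c f G \<beta>)) \<longleftrightarrow>
           (\<exists>l (f :: nat \<Rightarrow> real). l \<ge> 1 \<and> (\<forall>t\<ge>1. f t > 0) \<and>
              (\<forall>G\<in>\<G>. \<exists>\<beta>. covering l G \<beta> \<and> f_disjointed c f G \<beta>)))"
    (is "(?a \<longleftrightarrow> ?b) \<and> (?b \<longleftrightarrow> ?c) \<and> (?c \<longleftrightarrow> ?d) \<and> (?d \<longleftrightarrow> ?e)")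
proof -
  have wf: "wf_graph G" if "G \<in> \<G>" for G using cls that by (simp add: graph_class_def)
  have part_cov: "lpartition l G \<beta> \<Longrightarrow> covering l G \<beta>" for l and G :: "'a graph" and \<beta>
    by (simp add: lpartition_def)
  \<comment> \<open>The implications run in the cycle (a), (b), (d), (e), (c), (a); bounded
    treewidth enters in the last one.\<close>
  have ab: ?b if ?a
  proof -
    obtain w where "\<forall>G\<in>\<G>. tpw c G \<le> w" using \<open>?a\<close> by blast
    \<comment> \<open>Passing to \<open>w + 1\<close> makes both constants at least 1.\<close>
    then have "\<forall>G\<in>\<G>. tpw c G \<le> w + 1" by (auto intro: le_SucI)
    then have "\<forall>G\<in>\<G>. \<exists>\<beta>. lpartition (w + 1) G \<beta> \<and> disjointed c (real ((c + 1) * (w + 1))) G \<beta>"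
      using tpw_imp_disjointed_lpartition wf by blast
    then show ?b by (intro exI[of _ "(c + 1) * (w + 1)"] exI[of _ "w + 1"]) simp
  qed
  have bd: ?d if ?b
  proof -
    obtain d l where dl: "d \<ge> 1" "l \<ge> 1"
      "\<forall>G\<in>\<G>. \<exists>\<beta>. lpartition l G \<beta> \<and> disjointed c (real d) G \<beta>"
      using \<open>?b\<close> by blast
    then have "\<forall>G\<in>\<G>. \<exists>\<beta>. lpartition l G \<beta> \<and> f_disjointed c (\<lambda>t. real (t ^ c * d)) G \<beta>"
      using disjointed_imp_f_disjointed[OF wf part_cov] by blast
    \<comment> \<open>Positivity of the function at \<open>t \<ge> 1\<close> comes from
      \<open>d \<ge> 1\<close>.\<close>
    with dl show ?d by (intro exI[of _ l] exI[of _ "\<lambda>t. real (t ^ c * d)"]) simp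
  qed
  have de: ?e if ?d using that part_cov by meson
  have ec: ?c if ?e
  proof -
    obtain l f where lf: "l \<ge> 1" "\<forall>G\<in>\<G>. \<exists>\<beta>. covering l G \<beta> \<and> f_disjointed c f G \<beta>"
      using \<open>?e\<close> by blast
    then have "\<forall>G\<in>\<G>. \<exists>\<beta>. covering l G \<beta> \<and> disjointed c (real (nat \<lceil>f 1\<rceil> + 1)) G \<beta>"
      using f_disjointed_imp_disjointed by blast
    with lf show ?c by (intro exI[of _ "nat \<lceil>f 1\<rceil> + 1"] exI[of _ l]) simp
  qed
  have ca: ?a if ?c
  proof -
    obtain d l where dl: "\<forall>G\<in>\<G>. \<exists>\<beta>. covering l G \<beta> \<and> disjointed c (real d) G \<beta>"
      using \<open>?c\<close> by blast
    obtain k where k: "\<forall>G\<in>\<G>. treewidth G \<le> k" using btw by blast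
    obtain w where "\<And>(G :: 'a graph) \<beta>. wf_graph G \<Longrightarrow> treewidth G \<le> k \<Longrightarrow> covering l G \<beta> \<Longrightarrow>
        disjointed c (real d) G \<beta> \<Longrightarrow> tpw c G \<le> w"
      using disjointed_covering_imp_tpw[of k l c d] by blast
    then show ?a using dl k wf by blast
  qed
  from ab bd de ec ca show ?thesis by argo
qed

end
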